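(* There exists an absolute constant $c > 0$ such that the following holds. Let $A$ and $B$ be finite non-empty sets of integers and let $K_A, K_B$ be real numbers such that $|A+B| \leq K_A|A|$ and $|A+B| \leq K_B|B|$. Then $A+B$ contains an arithmetic progression of length at least \[ \exp\left( c \left(\frac{\log|A+B|}{K_B (\log (2K_A))^3} \right)^{1/2} - \log\bigl(2K_A\log(2|A|)\bigr) \right). \]
   Context: $A+B = \{a+b : a \in A, b \in B\}$. An arithmetic progression of length $L$ is a set of $L$ distinct integers of the form $\{a, a+d, \ldots, a+(L-1)d\}$ with $d \neq 0$. Logarithms are natural. *)

theory Defs
  imports Complex_Main "HOL-Library.Set_Algebras"
begin

text \<open>Sumsets are the library's pointwise \<open>+\<close> on sets. Since \<open>d \<noteq> 0\<close>, the \<open>L\<close> terms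
  below are pairwise distinct; singletons are progressions of length 1.\<close>

definition is_arith_prog :: "int set \<Rightarrow> nat \<Rightarrow> bool" where
  "is_arith_prog P L \<longleftrightarrow> (\<exists>a d. d \<noteq> 0 \<and> P = {a + int i * d | i. i < L})"

end

theory Submission
  imports Defs "HOL-Library.FuncSet" "HOL-Computational_Algebra.Primes"
begin

text \<open>
  The proof is the almost-periodicity argument of Croot, Laba and Sisask. Consider the average
  \<open>f x\<close>, over \<open>a \<in> A\<close>, of the indicator of \<open>x - a \<in> B\<close>. It is supported on \<open>A + B\<close> and has mean
  at least \<open>1 / K\<^sub>B\<close> there, so \<open>A + B\<close> contains a progression \<open>x, x + t, \<dots>, x + (L - 1) t\<close> as soon as
  some \<open>t\<close> can be found for which \<open>f\<close>, starting from a typical value, does not drop to zero along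
  these \<open>L\<close> translates.

  Fourier analysis needs a finite group. The Pluennecke--Ruzsa inequalities bound
  \<open>2A + 2B - 2A - 2B\<close> polynomially in \<open>K\<^sub>A\<close> and \<open>K\<^sub>B\<close>, and Ruzsa's dilation argument
  (\<open>ruzsa_model\<close>) then maps a quarter of \<open>A\<close> and a quarter of \<open>B\<close> into the integers modulo some \<open>N\<close>
  of that size, in such a way that progressions in the image of the sumset come from progressions
  in the sumset.

  Estimate \<open>f\<close> by sampling \<open>k\<close> points of \<open>A\<close>. On the square-root scale the error has a tail
  \<open>2 exp (- k \<eta>\<^sup>2)\<close> that does not depend on the value being estimated (\<open>sampling_tail\<close>). Only
  values of \<open>f\<close> of order \<open>1 / K\<^sub>B\<close> have to be told apart from zero, so \<open>\<eta>\<close> may be of order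
  \<open>K\<^sub>B powr (-1/2)\<close>; this is why the theorem loses a factor \<open>K\<^sub>B\<close> and not its square. Since
  \<open>A + B\<close> is small, many diagonal translates of good samples coincide, and the translations
  responsible form a set \<open>T \<subseteq> B\<close> of density at least \<open>K\<^sub>A powr (- k) / 2\<close> in \<open>B\<close>, all of whose differences are
  almost periods of \<open>f\<close> (\<open>almost_periods\<close>).

  Almost periods add up, so \<open>f\<close> changes little on average under sums of \<open>m\<close> differences of
  elements of \<open>T\<close>. The average \<open>g\<close> of \<open>f\<close> over all such sums has its Fourier coefficients multiplied
  by the \<open>2m\<close>-th power of those of \<open>T\<close>, so for \<open>m\<close> of order \<open>ln (2 K\<^sub>A K\<^sub>B)\<close> only the large spectrum
  of \<open>T\<close> is felt. By Chang's theorem (\<open>chang\<close>) that spectrum is controlled by about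
  \<open>ln (N / |T|)\<close> frequencies, and Dirichlet's pigeonhole argument yields a \<open>t\<close> whose first \<open>L\<close>
  multiples all nearly annihilate them. Then \<open>g\<close> is almost constant along \<open>x, x + t, \<dots>\<close>; it is
  of order \<open>1 / K\<^sub>B\<close> at a typical \<open>x\<close> with \<open>f x\<close> large and much smaller at a typical zero of \<open>f\<close>,
  so no such zero is met (\<open>progression_mod_N\<close>).

  The number of these frequencies is of order \<open>k ln (2 K\<^sub>A)\<close> with \<open>k\<close> of order \<open>m\<^sup>2 K\<^sub>B ln L\<close>, and the pigeonhole step
  needs \<open>ln N\<close> to exceed that number times \<open>ln L\<close>, up to constants. This is the requirement
  \<open>ln |A + B| \<ge> C K\<^sub>B ln (2 K\<^sub>A) (ln (2 K\<^sub>A K\<^sub>B))\<^sup>2 (ln L)\<^sup>2\<close> of \<open>long_progression_if_sumset_large\<close>. If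
  \<open>K\<^sub>B \<le> K\<^sub>A\<^sup>2\<close> the logarithms combine to \<open>(ln (2 K\<^sub>A))\<^sup>3\<close>. Otherwise one exchanges \<open>A\<close> and \<open>B\<close>: the
  requirement then involves only \<open>K\<^sub>A\<close> and logarithms of \<open>K\<^sub>B\<close>, which is \<open>O(K\<^sub>B)\<close>. The logarithm
  subtracted in the theorem separates a trivial range, where a singleton suffices, from a range
  where \<open>ln K\<^sub>A\<close>, \<open>ln K\<^sub>B\<close> and \<open>ln (ln |A + B|)\<close> are all dominated by the main term.
\<close>

section \<open>Pluennecke--Ruzsa inequalities\<close>
text \<open>Petridis's form of Pluennecke's inequality. Take \<open>X\<close> minimising the growth \<open>|X + B| / |X|\<close>
  and add the elements of \<open>C\<close> one at a time: the part of \<open>X\<close> whose translate is already covered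
  grows at least as fast as \<open>X\<close> itself, so each new translate adds at most the growth ratio times
  the number of new elements of \<open>X + C\<close>.\<close>
lemma petridis:
  fixes A B :: "'a::ab_group_add set" and K :: real
  assumes fin: "finite A" "finite B" and ne: "A \<noteq> {}"
    and doubling: "real (card (A + B)) \<le> K * real (card A)"
  obtains X where "X \<subseteq> A" "X \<noteq> {}"
    "\<And>C. finite C \<Longrightarrow> real (card (X + B + C)) \<le> K * real (card (X + C))"
proof -
  define rho where "rho Y = real (card (Y + B)) / real (card Y)" for Y
  define X where "X = arg_min_on rho (Pow A - {{}})"
  have fp: "finite (Pow A - {{}})" "Pow A - {{}} \<noteq> {}"
    using fin ne by auto
  have X: "X \<subseteq> A" "X \<noteq> {}"
    using arg_min_if_finite(1)[OF fp, of rho] unfolding X_def by auto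
  have min: "rho X \<le> rho Y" if "Y \<subseteq> A" "Y \<noteq> {}" for Y
    using arg_min_least[OF fp, of Y rho] that unfolding X_def by auto
  define k where "k = rho X"
  have finX: "finite X" using X fin finite_subset by blast
  have cX: "card X > 0" using X finX by (simp add: card_gt_0_iff)
  have kX: "real (card (X + B)) = k * real (card X)"
    using cX by (simp add: k_def rho_def)
  have kY: "k * real (card Y) \<le> real (card (Y + B))" if "Y \<subseteq> X" for Y
  proof (cases "Y = {}")
    case False
    then have "card Y > 0" using that finX by (simp add: card_gt_0_iff finite_subset)
    moreover have "k \<le> rho Y" using min[of Y] that False X by (auto simp: k_def)
    ultimately show ?thesis by (simp add: rho_def pos_le_divide_eq)
  qed auto
  have "k \<le> rho A" using min[of A] ne by (auto simp: k_def)
  also have "\<dots> \<le> K" using fin ne doubling by (simp add: rho_def pos_divide_le_eq card_gt_0_iff)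
  finally have kK: "k \<le> K" .
  have main: "real (card (X + B + C)) \<le> k * real (card (X + C))" if "finite C" for C
    using that
  proof (induction C rule: finite_induct)
    case empty
    then show ?case by simp
  next
    case (insert c C)
    define Y where "Y = {x \<in> X. x + c \<in> X + C}"
    have YX: "Y \<subseteq> X" and finY: "finite Y" using finX by (auto simp: Y_def)
    have fXB: "finite (X + B)" and fYB: "finite (Y + B)" and fXC: "finite (X + C)"
      and fXBC: "finite (X + B + C)"
      using finX finY fin insert by (auto intro!: finite_set_plus)
    have YB: "Y + B \<subseteq> X + B" using YX by (intro set_plus_mono2 order_refl)
    have e1: "X + insert c C = (X + C) \<union> (\<lambda>x. x + c) ` (X - Y)"
      by (auto simp: Y_def elim!: set_plus_elim)
    have "card (X + insert c C) = card (X + C) + card ((\<lambda>x. x + c) ` (X - Y))"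
      unfolding e1 using fXC finX by (intro card_Un_disjoint) (auto simp: Y_def)
    also have "card ((\<lambda>x. x + c) ` (X - Y)) = card X - card Y"
      using YX finY by (subst card_image) (auto simp: card_Diff_subset)
    finally have c1: "real (card (X + insert c C)) = real (card (X + C)) + real (card X) - real (card Y)"
      using card_mono[OF finX YX] by simp
    have e2: "X + B + insert c C \<subseteq> (X + B + C) \<union> (\<lambda>x. x + c) ` ((X + B) - (Y + B))"
    proof
      fix z assume "z \<in> X + B + insert c C"
      then obtain x b d where z: "x \<in> X" "b \<in> B" "d \<in> insert c C" "z = x + b + d"
        by (auto elim!: set_plus_elim)
      show "z \<in> (X + B + C) \<union> (\<lambda>x. x + c) ` ((X + B) - (Y + B))"
      proof (cases "d \<in> C")
        case False
        then have d: "d = c" using z by simp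
        show ?thesis
        proof (cases "x + b \<in> Y + B")
          case True
          then obtain y b' where y: "y \<in> Y" "b' \<in> B" "x + b = y + b'"
            by (auto elim!: set_plus_elim)
          then obtain x' c' where x': "x' \<in> X" "c' \<in> C" "y + c = x' + c'"
            by (auto simp: Y_def elim!: set_plus_elim)
          have "z = y + c + b'" using z y d by (simp add: algebra_simps)
          also have "\<dots> = x' + b' + c'" using x' by (simp add: algebra_simps)
          finally show ?thesis using x' y by auto
        qed (use z d in auto)
      qed (use z in auto)
    qed
    have "card (X + B + insert c C) \<le> card ((X + B + C) \<union> (\<lambda>x. x + c) ` ((X + B) - (Y + B)))"
      using fXBC fXB by (intro card_mono e2) auto
    also have "\<dots> \<le> card (X + B + C) + card ((\<lambda>x. x + c) ` ((X + B) - (Y + B)))"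
      by (rule card_Un_le)
    also have "card ((\<lambda>x. x + c) ` ((X + B) - (Y + B))) = card (X + B) - card (Y + B)"
      using YB fYB by (subst card_image) (auto simp: card_Diff_subset)
    finally have "real (card (X + B + insert c C))
        \<le> real (card (X + B + C)) + real (card (X + B)) - real (card (Y + B))"
      using card_mono[OF fXB YB] by simp
    also have "\<dots> \<le> k * real (card (X + C)) + k * real (card X) - k * real (card Y)"
      using insert.IH kX kY[OF YX] by linarith
    also have "\<dots> = k * real (card (X + insert c C))" by (simp add: c1 algebra_simps)
    finally show ?case .
  qed
  show ?thesis
  proof
    fix C :: "'a set" assume "finite C"
    from main[OF this] show "real (card (X + B + C)) \<le> K * real (card (X + C))"
      using mult_right_mono[OF kK, of "real (card (X + C))"] by linarith
  qed (use X in auto)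
qed

text \<open>Fix for each difference \<open>d\<close> one representation \<open>d = y - z\<close>. From \<open>(x + y, x + z)\<close> one recovers
  \<open>d\<close>, hence \<open>y\<close>, hence \<open>x\<close>.\<close>
lemma ruzsa_triangle:
  fixes X Y Z :: "'a::ab_group_add set"
  assumes "finite X" "finite Y" "finite Z"
  shows "card ((\<lambda>(y, z). y - z) ` (Y \<times> Z)) * card X \<le> card (X + Y) * card (X + Z)"
proof -
  let ?D = "(\<lambda>(y, z). y - z) ` (Y \<times> Z)"
  have "\<exists>p. \<forall>d\<in>?D. p d \<in> Y \<times> Z \<and> fst (p d) - snd (p d) = d"
    by (rule bchoice) auto
  then obtain p where p: "\<And>d. d \<in> ?D \<Longrightarrow> p d \<in> Y \<times> Z \<and> fst (p d) - snd (p d) = d"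
    by blast
  define h where "h = (\<lambda>(d, x). (x + fst (p d), x + snd (p d)))"
  have "inj_on h (?D \<times> X)"
  proof (rule inj_onI)
    fix u v assume uv: "u \<in> ?D \<times> X" "v \<in> ?D \<times> X" "h u = h v"
    obtain d x d' x' where u: "u = (d, x)" and v: "v = (d', x')" by fastforce
    have e: "x + fst (p d) = x' + fst (p d')" "x + snd (p d) = x' + snd (p d')"
      using uv by (auto simp: h_def u v)
    have "d = (x + fst (p d)) - (x + snd (p d))" using p[of d] uv u by auto
    also have "\<dots> = (x' + fst (p d')) - (x' + snd (p d'))" using e by simp
    also have "\<dots> = d'" using p[of d'] uv v by auto
    finally have "d = d'" .
    then show "u = v" using e u v by auto
  qed
  moreover have "h ` (?D \<times> X) \<subseteq> (X + Y) \<times> (X + Z)"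
    using p by (fastforce simp: h_def mem_Times_iff)
  ultimately have "card (?D \<times> X) \<le> card ((X + Y) \<times> (X + Z))"
    using assms by (intro card_inj_on_le) (auto intro: finite_set_plus)
  then show ?thesis by (simp add: card_cartesian_product)
qed

lemma card_le_card_plus:
  fixes X Y :: "'a::ab_group_add set"
  assumes "finite X" "finite Y" "Y \<noteq> {}"
  shows "card X \<le> card (X + Y)" "card X \<le> card (Y + X)"
proof -
  obtain y where y: "y \<in> Y" using assms by auto
  have "card X = card ((\<lambda>x. x + y) ` X)" by (subst card_image) auto
  also have "\<dots> \<le> card (X + Y)"
    using assms y by (intro card_mono finite_set_plus) auto
  finally show "card X \<le> card (X + Y)" .
  then show "card X \<le> card (Y + X)" by (simp add: add.commute)
qed

text \<open>Petridis's lemma in one direction bounds \<open>3B\<close> in terms of \<open>A\<close>; in the other it gives \<open>V \<subseteq> B\<close>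
  with \<open>V + U\<close> small, and Ruzsa's triangle inequality with pivot \<open>V\<close> passes to \<open>U - U\<close>.\<close>
lemma card_double_sumset_differences:
  fixes A B :: "'a::ab_group_add set" and KA KB :: real
  defines "U \<equiv> A + A + B + B"
  assumes fin: "finite A" "finite B" and ne: "A \<noteq> {}" "B \<noteq> {}"
    and KA: "real (card (A + B)) \<le> KA * real (card A)"
    and KB: "real (card (A + B)) \<le> KB * real (card B)"
  shows "real (card ((\<lambda>(u, v). u - v) ` (U \<times> U))) \<le> KA ^ 6 * KB ^ 6 * real (card B)"
proof -
  have finU: "finite U" using fin unfolding U_def by (intro finite_set_plus)
  have pos: "card A > 0" "card B > 0" using fin ne by (auto simp: card_gt_0_iff)
  have AB: "card A \<le> card (A + B)" "card B \<le> card (A + B)"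
    using card_le_card_plus fin ne by auto
  then have "KA * real (card A) > 0" "KB * real (card B) > 0" using KA KB pos by linarith+
  then have K0: "KA > 0" "KB > 0" using pos by (auto simp: zero_less_mult_iff)
  from petridis[OF fin ne(1) KA] obtain X where X: "X \<subseteq> A" "X \<noteq> {}"
    "\<And>C. finite C \<Longrightarrow> real (card (X + B + C)) \<le> KA * real (card (X + C))" by blast
  have KB': "real (card (B + A)) \<le> KB * real (card B)" using KB by (simp add: add.commute)
  from petridis[OF fin(2,1) ne(2) KB'] obtain V where V: "V \<subseteq> B" "V \<noteq> {}"
    "\<And>C. finite C \<Longrightarrow> real (card (V + A + C)) \<le> KB * real (card (V + C))" by blast
  have finX: "finite X" and finV: "finite V" using X V fin finite_subset by blast+
  have "real (card (B + B + B)) \<le> real (card (X + B + (B + B)))"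
    using card_le_card_plus(2)[of "B + B + B" X] X finX fin
    by (simp add: finite_set_plus add.assoc)
  also have "\<dots> \<le> KA * real (card (X + B + B))"
    using X(3)[of "B + B"] fin by (simp add: finite_set_plus add.assoc)
  also have "\<dots> \<le> KA * (KA * real (card (X + B)))"
    using X(3)[of B] fin K0 by (intro mult_left_mono) auto
  also have "\<dots> \<le> KA * (KA * (KA * real (card X)))"
    using X(3)[of "{0}"] K0 by (intro mult_left_mono) auto
  also have "\<dots> \<le> KA * (KA * (KA * real (card A)))"
    using card_mono[OF fin(1) X(1)] K0 by (intro mult_left_mono) auto
  finally have BBB: "real (card (B + B + B)) \<le> KA ^ 3 * real (card A)"
    by (simp add: power3_eq_cube mult.assoc)
  have "real (card (V + U)) = real (card (V + A + (A + B + B)))"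
    by (simp add: U_def add.assoc)
  also have "\<dots> \<le> KB * real (card (V + A + (B + B)))"
    using V(3)[of "A + B + B"] fin by (simp add: finite_set_plus add.assoc)
  also have "\<dots> \<le> KB * (KB * real (card (V + (B + B))))"
    using V(3)[of "B + B"] fin K0 by (intro mult_left_mono) (auto simp: finite_set_plus)
  also have "\<dots> \<le> KB * (KB * real (card (B + B + B)))"
  proof -
    have "V + (B + B) \<subseteq> B + B + B" unfolding add.assoc by (intro set_plus_mono2 order_refl V(1))
    then show ?thesis using K0 fin
      by (intro mult_left_mono of_nat_mono card_mono finite_set_plus) auto
  qed
  also have "\<dots> \<le> KB * (KB * (KA ^ 3 * real (card A)))"
    using BBB K0 by (intro mult_left_mono) auto
  finally have VU: "real (card (V + U)) \<le> KB ^ 2 * KA ^ 3 * real (card A)"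
    by (simp add: power2_eq_square mult.assoc)
  \<comment> \<open>\<open>V\<close> may be much smaller than \<open>B\<close>, but \<open>V + A\<close> is at least as large as \<open>A\<close>.\<close>
  have "real (card A) \<le> real (card (V + A))" using card_le_card_plus(2)[OF fin(1) finV V(2)] by simp
  also have "\<dots> \<le> KB * real (card V)" using V(3)[of "{0}"] by simp
  finally have AV: "real (card A) \<le> KB * real (card V)" .
  let ?D = "real (card ((\<lambda>(u, v). u - v) ` (U \<times> U)))"
  have "card ((\<lambda>(u, v). u - v) ` (U \<times> U)) * card V \<le> card (V + U) * card (V + U)"
    by (rule ruzsa_triangle[OF finV finU finU])
  then have "?D * real (card V) \<le> real (card (V + U)) * real (card (V + U))"
    by (metis of_nat_mono of_nat_mult)
  also have "\<dots> \<le> (KB ^ 2 * KA ^ 3 * real (card A)) * (KB ^ 2 * KA ^ 3 * real (card A))"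
    using VU K0 by (intro mult_mono) auto
  finally have t: "?D * real (card V) \<le> KB ^ 4 * KA ^ 6 * real (card A) * real (card A)"
    by (simp add: algebra_simps power_add[symmetric] flip: power_add)
  have "?D * real (card A) \<le> ?D * (KB * real (card V))"
    using AV by (intro mult_left_mono) auto
  also have "\<dots> \<le> KB * (KB ^ 4 * KA ^ 6 * real (card A) * real (card A))"
    using mult_left_mono[OF t, of KB] K0 by (simp add: mult_ac)
  also have "\<dots> = (KB ^ 5 * KA ^ 6 * real (card A)) * real (card A)"
    by (simp add: eval_nat_numeral)
  finally have "?D \<le> KB ^ 5 * KA ^ 6 * real (card A)" using pos by simp
  also have "\<dots> \<le> KB ^ 5 * KA ^ 6 * (KB * real (card B))"
    using AB(1) KB K0 by (intro mult_left_mono) auto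
  finally show ?thesis by (simp add: eval_nat_numeral mult_ac)
qed

section \<open>Modelling in a cyclic group\<close>
lemma pigeonhole_quarters:
  fixes A :: "'a set" and h :: "'a \<Rightarrow> int"
  assumes "finite A" "\<And>a. a \<in> A \<Longrightarrow> h a \<in> {0..<4}"
  obtains j where "card A \<le> 4 * card {a \<in> A. h a = j}"
proof -
  have "card A = (\<Sum>j\<in>{0..<4::int}. card {a \<in> A. h a = j})"
    using assms by (subst card_eq_sum, subst sum.group[of A "{0..<4::int}" h, symmetric]) auto
  moreover have "{0..<4::int} = {0, 1, 2, 3}" by auto
  ultimately have sum: "card A = card {a \<in> A. h a = 0} + card {a \<in> A. h a = 1}
      + card {a \<in> A. h a = 2} + card {a \<in> A. h a = 3}"
    by simp
  show ?thesis
  proof (rule ccontr)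
    assume "\<not> thesis"
    then have "4 * card {a \<in> A. h a = j} < card A" for j using that[of j] by linarith
    from this[of 0] this[of 1] this[of 2] this[of 3] sum show False by linarith
  qed
qed

text \<open>Let \<open>q\<close> be a large prime and \<open>psi x = l * x mod q\<close>. A fixed nonzero \<open>s\<close> is sent to a multiple of \<open>N\<close>
  by at most one in \<open>N\<close> of the multipliers \<open>l\<close>, so when \<open>N\<close> is at least the number of elements of
  \<open>2A + 2B - 2A - 2B\<close> some \<open>l\<close> avoids this for all of its nonzero elements. Restricting \<open>A\<close> and \<open>B\<close> to
  the preimages of intervals of length \<open>q / 4\<close> makes every alternating sum of images smaller than
  \<open>q\<close> in absolute value, so that reduction modulo \<open>q\<close> loses nothing. The two conclusions are
  stated for the combinations \<open>(s1 - s2) + (s3 - s4)\<close> of sums \<open>s = a + b\<close>: taking \<open>s3 = s4\<close> gives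
  equality of sums, and \<open>s2 = s4\<close> gives second differences, which detect progressions.\<close>
lemma ruzsa_model:
  fixes A B :: "int set" and N :: nat
  defines "U \<equiv> A + A + B + B"
  assumes fin: "finite A" "finite B" and ne: "A \<noteq> {}" "B \<noteq> {}"
    and N: "card ((\<lambda>(u, v). u - v) ` (U \<times> U)) \<le> N"
  obtains A' B' and psi :: "int \<Rightarrow> int" where
    "A' \<subseteq> A" "B' \<subseteq> B" "card A \<le> 4 * card A'" "card B \<le> 4 * card B'"
    "\<And>a1 a2 a3 a4 b1 b2 b3 b4.
       \<lbrakk>{a1, a2, a3, a4} \<subseteq> A'; {b1, b2, b3, b4} \<subseteq> B';
        (a1 + b1) - (a2 + b2) + ((a3 + b3) - (a4 + b4)) = 0\<rbrakk> \<Longrightarrow>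
       (psi a1 + psi b1) - (psi a2 + psi b2) + ((psi a3 + psi b3) - (psi a4 + psi b4)) = 0"
    "\<And>a1 a2 a3 a4 b1 b2 b3 b4.
       \<lbrakk>{a1, a2, a3, a4} \<subseteq> A'; {b1, b2, b3, b4} \<subseteq> B';
        int N dvd (psi a1 + psi b1) - (psi a2 + psi b2) + ((psi a3 + psi b3) - (psi a4 + psi b4))\<rbrakk> \<Longrightarrow>
       (a1 + b1) - (a2 + b2) + ((a3 + b3) - (a4 + b4)) = 0"
proof -
  define D where "D = (\<lambda>(u, v). u - v) ` (U \<times> U)"
  have finU: "finite U" using fin unfolding U_def by (intro finite_set_plus)
  have finD: "finite D" using finU by (simp add: D_def)
  obtain a0 b0 where "a0 \<in> A" "b0 \<in> B" using ne by auto
  then have "a0 + a0 + b0 + b0 \<in> U" unfolding U_def by (intro set_plus_intro)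
  then have zD: "0 \<in> D" by (force simp: D_def)
  have N0: "N > 0" using N zD finD by (metis D_def card_gt_0_iff empty_iff gr0I le_zero_eq)
  obtain q' :: nat where q': "prime q'" "nat (Max (abs ` D)) + 1 < q'" using bigger_prime by blast
  define q where "q = int q'"
  have qp: "prime q" using q' by (simp add: q_def)
  have q1: "q > 1" using q' by (simp add: q_def)
  have qD: "\<bar>s\<bar> < q" if "s \<in> D" for s
  proof -
    have "\<bar>s\<bar> \<le> Max (abs ` D)" using that finD by (intro Max_ge) auto
    then show ?thesis using q' by (simp add: q_def)
  qed
  \<comment> \<open>\<open>bad s\<close> are the multipliers for which the dilate of \<open>s\<close> vanishes modulo \<open>N\<close>.\<close>
  define bad where "bad s = {l \<in> {1..<q}. int N dvd (l * s mod q)}" for s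
  have bad: "card (bad s) \<le> (q' - 1) div N" if s: "s \<in> D - {0}" for s
  proof -
    have cop: "\<not> q dvd s"
      using qD[of s] s dvd_imp_le_int[of s q] q1 by auto
    have "inj_on (\<lambda>l. l * s mod q) (bad s)"
    proof (rule inj_onI)
      fix l l' assume l: "l \<in> bad s" "l' \<in> bad s" "l * s mod q = l' * s mod q"
      then have "q dvd (l - l') * s" by (simp add: mod_eq_dvd_iff left_diff_distrib)
      then have "q dvd l - l'" using qp cop prime_dvd_mult_iff by blast
      moreover have "\<bar>l - l'\<bar> < q" using l by (auto simp: bad_def)
      ultimately show "l = l'" using dvd_imp_le_int[of "l - l'" q] q1 by linarith
    qed
    moreover have "(\<lambda>l. l * s mod q) ` bad s \<subseteq> (\<lambda>i. int N * int i) ` {1..(q' - 1) div N}"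
    proof
      fix v assume "v \<in> (\<lambda>l. l * s mod q) ` bad s"
      then obtain l where l: "l \<in> {1..<q}" "int N dvd v" "v = l * s mod q" by (auto simp: bad_def)
      have "\<not> q dvd l" using l q1 by (auto dest: zdvd_imp_le)
      then have "v \<noteq> 0" using l qp cop by (auto simp: prime_dvd_mult_iff dvd_eq_mod_eq_0[symmetric])
      then have v: "0 < v" "v < q" using l q1 pos_mod_sign[of q "l * s"] pos_mod_bound[of q "l * s"] by linarith+
      from l obtain i where i: "v = int N * i" by (auto elim: dvdE)
      have i0: "i > 0" using i v by (simp add: zero_less_mult_iff)
      have "int (N * nat i) \<le> int (q' - 1)" using i v i0 q' by (simp add: q_def of_nat_diff)
      then have "N * nat i \<le> q' - 1" by linarith
      then have "nat i \<le> (q' - 1) div N"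
        using N0 by (simp add: less_eq_div_iff_mult_less_eq mult.commute)
      then show "v \<in> (\<lambda>i. int N * int i) ` {1..(q' - 1) div N}"
        using i i0 by (intro image_eqI[of _ _ "nat i"]) auto
    qed
    ultimately have "card (bad s) \<le> card ((\<lambda>i. int N * int i) ` {1..(q' - 1) div N})"
      by (rule card_inj_on_le) simp
    also have "\<dots> \<le> card {1..(q' - 1) div N}" by (rule card_image_le) simp
    also have "\<dots> = (q' - 1) div N" by simp
    finally show ?thesis .
  qed
  have "card (\<Union>s\<in>D - {0}. bad s) \<le> (\<Sum>s\<in>D - {0}. card (bad s))"
    using finD by (intro card_UN_le) auto
  also have "\<dots> \<le> (\<Sum>s\<in>D - {0}. (q' - 1) div N)" by (intro sum_mono bad)
  also have "\<dots> = (card D - 1) * ((q' - 1) div N)" using zD finD by simp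
  also have "\<dots> \<le> (N - 1) * ((q' - 1) div N)" using N by (intro mult_right_mono) (auto simp: D_def)
  also have "\<dots> < q' - 1"
  proof (cases "(q' - 1) div N = 0")
    case True
    then show ?thesis using q' by simp
  next
    case False
    then have "(N - 1) * ((q' - 1) div N) < N * ((q' - 1) div N)" using N0 by simp
    also have "\<dots> \<le> q' - 1" by simp
    finally show ?thesis .
  qed
  also have "q' - 1 = card {1..<q}" by (simp add: q_def)
  finally have less: "card (\<Union>s\<in>D - {0}. bad s) < card {1..<q}" .
  have "finite (\<Union>s\<in>D - {0}. bad s)"
    by (rule finite_subset[of _ "{1..<q}"]) (auto simp: bad_def)
  from card_mono[OF this, of "{1..<q}"] less
  have "\<not> {1..<q} \<subseteq> (\<Union>s\<in>D - {0}. bad s)" by linarith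
  then obtain l where l0: "l \<in> {1..<q}" "l \<notin> (\<Union>s\<in>D - {0}. bad s)" by blast
  have l: "l \<in> {1..<q}" "\<And>s. s \<in> D \<Longrightarrow> s \<noteq> 0 \<Longrightarrow> \<not> int N dvd (l * s mod q)"
    using l0 by (auto simp: bad_def)
  define psi where "psi x = l * x mod q" for x
  define h where "h x = 4 * psi x div q" for x
  have psi: "0 \<le> psi x" "psi x < q" for x using q1 by (auto simp: psi_def)
  have h: "h x \<in> {0..<4}" for x
  proof -
    have "4 * psi x < 4 * q" using psi[of x] by simp
    moreover have "h x * q \<le> 4 * psi x"
      using q1 div_mult_mod_eq[of "4 * psi x" q] pos_mod_sign[of q "4 * psi x"]
      unfolding h_def by linarith
    ultimately have "h x * q < 4 * q" by linarith
    then have "h x < 4" using q1 by simp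
    then show ?thesis using psi[of x] q1 by (auto simp: h_def pos_imp_zdiv_nonneg_iff)
  qed
  have close: "4 * (psi x - psi y) < q" if "h x = h y" for x y
  proof -
    have "4 * psi x = h x * q + (4 * psi x) mod q" "4 * psi y = h y * q + (4 * psi y) mod q"
      by (simp_all add: h_def)
    moreover have "0 \<le> (4 * psi y) mod q" "(4 * psi x) mod q < q" using q1 by auto
    ultimately have "4 * psi x - 4 * psi y < q" using that by simp
    then show ?thesis by simp
  qed
  obtain i where i: "card A \<le> 4 * card {a \<in> A. h a = i}"
    using pigeonhole_quarters[OF fin(1), of h] h by blast
  obtain j where j: "card B \<le> 4 * card {b \<in> B. h b = j}"
    using pigeonhole_quarters[OF fin(2), of h] h by blast
  define A' where "A' = {a \<in> A. h a = i}"
  define B' where "B' = {b \<in> B. h b = j}"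
  let ?S = "\<lambda>a1 b1 a2 b2 a3 b3 a4 b4 :: int. (a1 + b1) - (a2 + b2) + ((a3 + b3) - (a4 + b4))"
  have small: "\<bar>?S (psi a1) (psi b1) (psi a2) (psi b2) (psi a3) (psi b3) (psi a4) (psi b4)\<bar> < q"
    if "{a1, a2, a3, a4} \<subseteq> A'" "{b1, b2, b3, b4} \<subseteq> B'" for a1 a2 a3 a4 b1 b2 b3 b4
    using that close[of a1 a2] close[of a2 a1] close[of a3 a4] close[of a4 a3]
      close[of b1 b2] close[of b2 b1] close[of b3 b4] close[of b4 b3]
    unfolding A'_def B'_def by auto
  have modq: "?S (psi a1) (psi b1) (psi a2) (psi b2) (psi a3) (psi b3) (psi a4) (psi b4) mod q
      = l * ?S a1 b1 a2 b2 a3 b3 a4 b4 mod q" for a1 a2 a3 a4 b1 b2 b3 b4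
  proof -
    have "psi x = l * x - q * (l * x div q)" for x
      by (simp add: psi_def minus_mult_div_eq_mod)
    then have "?S (psi a1) (psi b1) (psi a2) (psi b2) (psi a3) (psi b3) (psi a4) (psi b4)
        - l * ?S a1 b1 a2 b2 a3 b3 a4 b4
        = q * ?S (l * a2 div q) (l * b2 div q) (l * a1 div q) (l * b1 div q)
            (l * a4 div q) (l * b4 div q) (l * a3 div q) (l * b3 div q)"
      by (simp only:) (simp only: algebra_simps)
    then show ?thesis by (metis mod_eq_dvd_iff dvd_triv_left)
  qed
  have inD: "?S a1 b1 a2 b2 a3 b3 a4 b4 \<in> D"
    if "{a1, a2, a3, a4} \<subseteq> A'" "{b1, b2, b3, b4} \<subseteq> B'" for a1 a2 a3 a4 b1 b2 b3 b4
  proof -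
    have "a1 + a3 + b1 + b3 \<in> U" "a2 + a4 + b2 + b4 \<in> U"
      using that unfolding U_def A'_def B'_def by (auto intro!: set_plus_intro)
    then have "(a1 + a3 + b1 + b3) - (a2 + a4 + b2 + b4) \<in> D" by (force simp: D_def)
    then show ?thesis by (simp add: algebra_simps)
  qed
  have symD: "- s \<in> D" if "s \<in> D" for s using that by (force simp: D_def)
  show ?thesis
  proof (rule that[of A' B' psi])
    show "A' \<subseteq> A" "B' \<subseteq> B" "card A \<le> 4 * card A'" "card B \<le> 4 * card B'"
      using i j by (auto simp: A'_def B'_def)
  next
    fix a1 a2 a3 a4 b1 b2 b3 b4
    assume a: "{a1, a2, a3, a4} \<subseteq> A'" "{b1, b2, b3, b4} \<subseteq> B'" "?S a1 b1 a2 b2 a3 b3 a4 b4 = 0"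
    have "q dvd ?S (psi a1) (psi b1) (psi a2) (psi b2) (psi a3) (psi b3) (psi a4) (psi b4)"
      using modq[of a1 b1 a2 b2 a3 b3 a4 b4] unfolding a(3) by (simp add: dvd_eq_mod_eq_0)
    with small[OF a(1,2)] dvd_imp_le_int[of "?S (psi a1) (psi b1) (psi a2) (psi b2) (psi a3) (psi b3) (psi a4) (psi b4)" q] q1
    show "?S (psi a1) (psi b1) (psi a2) (psi b2) (psi a3) (psi b3) (psi a4) (psi b4) = 0"
      by linarith
  next
    fix a1 a2 a3 a4 b1 b2 b3 b4
    let ?s = "?S a1 b1 a2 b2 a3 b3 a4 b4"
    let ?t = "?S (psi a1) (psi b1) (psi a2) (psi b2) (psi a3) (psi b3) (psi a4) (psi b4)"
    assume a: "{a1, a2, a3, a4} \<subseteq> A'" "{b1, b2, b3, b4} \<subseteq> B'" "int N dvd ?t"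
    note tq = small[OF a(1,2)] and sD = inD[OF a(1,2)]
    have tm: "?t mod q = l * ?s mod q" by (rule modq)
    show "?s = 0"
    proof (rule ccontr)
      assume s: "?s \<noteq> 0"
      show False
      proof (cases "?t \<ge> 0")
        case True
        then have "l * ?s mod q = ?t" using tm tq by simp
        then show False using l(2)[OF sD s] a(3) by simp
      next
        case False
        have "(l * (- ?s)) mod q = (- ?t) mod q" using tm by (metis mod_minus_cong mult_minus_right)
        also have "\<dots> = - ?t" using False tq by simp
        finally have e: "(l * (- ?s)) mod q = - ?t" .
        have "- ?s \<noteq> 0" using s by linarith
        from l(2)[OF symD[OF sD] this] show False unfolding e using a(3) dvd_minus_iff by blast
      qed
    qed
  qed
qed

section \<open>Random sampling\<close>
text \<open>The moment generating function of a binomial distribution, with tuples counted instead of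
  weighted by probabilities.\<close>
lemma sum_power_hits:
  fixes S A :: "'a set" and r :: real
  assumes "finite A" "S \<subseteq> A"
  shows "(\<Sum>a\<in>{..<k::nat} \<rightarrow>\<^sub>E A. r ^ card {i \<in> {..<k}. a i \<in> S})
    = (real (card A) - real (card S) + r * real (card S)) ^ k"
proof -
  have "(\<Sum>a\<in>{..<k} \<rightarrow>\<^sub>E A. r ^ card {i \<in> {..<k}. a i \<in> S})
      = (\<Sum>a\<in>{..<k} \<rightarrow>\<^sub>E A. \<Prod>i<k. if a i \<in> S then r else 1)"
    by (intro sum.cong) (auto simp: prod.If_cases Int_def conj_commute)
  also have "\<dots> = (\<Prod>i<k. \<Sum>y\<in>A. if y \<in> S then r else 1)"
    by (subst prod_sum_PiE) (use assms in auto)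
  also have "(\<Sum>y\<in>A. if y \<in> S then r else 1) = r * real (card S) + real (card (A - S))"
    using assms by (simp add: sum.If_cases Int_absorb1 Diff_eq)
  also have "real (card (A - S)) = real (card A) - real (card S)"
    using assms by (simp add: card_Diff_subset finite_subset card_mono of_nat_diff)
  finally show ?thesis by (simp add: add.commute)
qed

text \<open>Chernoff's method with base \<open>r = y / s\<close>, \<open>s = sqrt phi\<close>. Bounding \<open>ln r\<close> from below by
  \<open>1 - s / y\<close> makes the exponent exactly \<open>- k (y - s)\<^sup>2\<close>. The sign condition covers the upper tail
  (\<open>y > s\<close>) and the lower tail (\<open>y < s\<close>) at once.\<close>
lemma sampling_one_sided_tail:
  fixes S A :: "'a set" and y :: real
  defines "phi \<equiv> real (card S) / real (card A)"
  assumes A: "finite A" "S \<subseteq> A" "S \<noteq> {}" and y: "y > 0"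
  shows "real (card {a \<in> {..<k::nat} \<rightarrow>\<^sub>E A.
      (real (card {i \<in> {..<k}. a i \<in> S}) - real k * y\<^sup>2) * (y - sqrt phi) \<ge> 0})
    \<le> exp (- real k * (y - sqrt phi)\<^sup>2) * real (card A) ^ k"
proof -
  let ?P = "{..<k} \<rightarrow>\<^sub>E A"
  let ?c = "\<lambda>a. card {i \<in> {..<k}. a i \<in> S}"
  define E where "E = {a \<in> ?P. (real (?c a) - real k * y\<^sup>2) * (y - sqrt phi) \<ge> 0}"
  define s where "s = sqrt phi"
  have cA: "card A > 0" "card S > 0" using A by (auto simp: card_gt_0_iff finite_subset)
  have phi: "phi > 0" using cA by (simp add: phi_def)
  have s: "s > 0" "s\<^sup>2 = phi" using phi by (auto simp: s_def)
  have finP: "finite ?P" using A by (intro finite_PiE) auto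
  define r where "r = y / s"
  have r: "r > 0" using y s by (simp add: r_def)
  have ln_r: "ln r \<ge> 1 - s / y"
    using ln_le_minus_one[of "1 / r"] r y s by (simp add: ln_div r_def)
  have lb: "exp (real k * (y\<^sup>2 - y * s)) \<le> r ^ ?c a" if "a \<in> E" for a
  proof -
    have sgn: "(real (?c a) - real k * y\<^sup>2) * ln r \<ge> 0"
    proof (cases "y \<ge> s")
      case True
      then have "ln r \<ge> 0" using s by (intro ln_ge_zero) (simp add: r_def)
      moreover have "real (?c a) - real k * y\<^sup>2 \<ge> 0 \<or> y = s"
        using that True by (auto simp: E_def s_def[symmetric] zero_le_mult_iff)
      ultimately show ?thesis using s by (auto simp: r_def)
    next
      case False
      then have "ln r \<le> 0" using s r by (simp add: r_def)
      moreover have "real (?c a) - real k * y\<^sup>2 \<le> 0"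
        using that False by (auto simp: E_def s_def[symmetric] zero_le_mult_iff)
      ultimately show ?thesis by (simp add: mult_nonpos_nonpos)
    qed
    have "real k * (y\<^sup>2 - y * s) = real k * y\<^sup>2 * (1 - s / y)"
      using y by (simp add: field_simps power2_eq_square)
    also have "\<dots> \<le> real k * y\<^sup>2 * ln r" using ln_r by (intro mult_left_mono) auto
    also have "\<dots> \<le> real (?c a) * ln r" using sgn by (simp add: left_diff_distrib)
    finally have "exp (real k * (y\<^sup>2 - y * s)) \<le> exp (real (?c a) * ln r)" by simp
    also have "\<dots> = r ^ ?c a" using r by (simp add: exp_of_nat_mult)
    finally show ?thesis .
  qed
  have "real (card E) * exp (real k * (y\<^sup>2 - y * s)) = (\<Sum>a\<in>E. exp (real k * (y\<^sup>2 - y * s)))" by simp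
  also have "\<dots> \<le> (\<Sum>a\<in>E. r ^ ?c a)" by (intro sum_mono lb)
  also have "\<dots> \<le> (\<Sum>a\<in>?P. r ^ ?c a)"
    using r finP by (intro sum_mono2) (auto simp: E_def)
  also have "\<dots> = (real (card A) - real (card S) + r * real (card S)) ^ k"
    by (rule sum_power_hits[OF A(1,2)])
  also have "real (card A) - real (card S) + r * real (card S) = real (card A) * (1 + phi * (r - 1))"
    using cA by (simp add: phi_def field_simps)
  also have "(real (card A) * (1 + phi * (r - 1))) ^ k
      \<le> (real (card A) * exp (phi * (r - 1))) ^ k"
  proof -
    have "phi \<le> 1" using cA A by (simp add: phi_def card_mono)
    moreover have "phi * r > 0" using r phi by simp
    ultimately have "1 + phi * (r - 1) \<ge> 0" by (simp add: algebra_simps)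
    moreover have "1 + phi * (r - 1) \<le> exp (phi * (r - 1))" by (rule exp_ge_add_one_self)
    ultimately show ?thesis by (intro power_mono mult_left_mono) auto
  qed
  also have "\<dots> = real (card A) ^ k * exp (real k * (phi * (r - 1)))"
    by (simp add: power_mult_distrib exp_of_nat_mult)
  also have "phi * (r - 1) = y * s - s\<^sup>2"
    using s by (simp add: r_def field_simps power2_eq_square flip: s(2))
  finally have "real (card E) * exp (real k * (y\<^sup>2 - y * s)) \<le> real (card A) ^ k * exp (real k * (y * s - s\<^sup>2))" .
  then have "real (card E) \<le> real (card A) ^ k * (exp (real k * (y * s - s\<^sup>2)) / exp (real k * (y\<^sup>2 - y * s)))"
    by (simp add: pos_le_divide_eq)
  also have "exp (real k * (y * s - s\<^sup>2)) / exp (real k * (y\<^sup>2 - y * s)) = exp (- real k * (y - s)\<^sup>2)"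
    by (simp add: power2_eq_square algebra_simps flip: exp_diff)
  finally show ?thesis by (simp add: E_def s_def mult.commute)
qed

text \<open>The bound vanishes for empty \<open>S\<close>, so that only points in the support of a convolution can
  contribute to the number of badly sampled points.\<close>
lemma sampling_tail:
  fixes S A :: "'a set" and eta :: real
  assumes A: "finite A" "S \<subseteq> A" and k: "k > 0" and eta: "eta > 0"
  shows "real (card {a \<in> {..<k::nat} \<rightarrow>\<^sub>E A.
      \<bar>sqrt (real (card {i \<in> {..<k}. a i \<in> S}) / real k) - sqrt (real (card S) / real (card A))\<bar> > eta})
    \<le> (if S = {} then 0 else 2 * exp (- real k * eta\<^sup>2) * real (card A) ^ k)"
proof (cases "S = {}")
  case True
  then show ?thesis using eta by simp
next
  case False
  let ?P = "{..<k} \<rightarrow>\<^sub>E A"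
  let ?c = "\<lambda>a. real (card {i \<in> {..<k}. a i \<in> S})"
  define s where "s = sqrt (real (card S) / real (card A))"
  define T where "T y = {a \<in> ?P. (?c a - real k * y\<^sup>2) * (y - s) \<ge> 0}" for y
  have s0: "s \<ge> 0" by (simp add: s_def)
  have finP: "finite ?P" using A by (intro finite_PiE) auto
  have tail: "real (card (T y)) \<le> exp (- real k * (y - s)\<^sup>2) * real (card A) ^ k" if "y > 0" for y
    using sampling_one_sided_tail[OF A False that, of k] by (simp add: T_def s_def)
  let ?E = "{a \<in> ?P. \<bar>sqrt (?c a / real k) - s\<bar> > eta}"
  have up: "a \<in> T (s + eta)" if "a \<in> ?P" "sqrt (?c a / real k) - s > eta" for a
  proof -
    have "(s + eta)\<^sup>2 \<le> (sqrt (?c a / real k))\<^sup>2"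
      using that s0 eta by (intro power_mono) auto
    also have "\<dots> = ?c a / real k" by simp
    finally have "real k * (s + eta)\<^sup>2 \<le> ?c a" using k by (simp add: pos_le_divide_eq mult.commute)
    then have "(?c a - real k * (s + eta)\<^sup>2) * (s + eta - s) \<ge> 0"
      using eta by (intro mult_nonneg_nonneg) auto
    then show ?thesis using that(1) unfolding T_def by blast
  qed
  have low: "s - eta > 0 \<and> a \<in> T (s - eta)" if "a \<in> ?P" "s - sqrt (?c a / real k) > eta" for a
  proof -
    have "?c a / real k = (sqrt (?c a / real k))\<^sup>2" by simp
    also have "\<dots> \<le> (s - eta)\<^sup>2" using that by (intro power_mono) auto
    finally have "?c a \<le> real k * (s - eta)\<^sup>2" using k by (simp add: pos_divide_le_eq mult.commute)
    then have "(?c a - real k * (s - eta)\<^sup>2) * (s - eta - s) \<ge> 0"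
      using eta by (intro mult_nonpos_nonpos) auto
    then have "a \<in> T (s - eta)" using that(1) unfolding T_def by blast
    moreover have "sqrt (?c a / real k) \<ge> 0" by simp
    then have "s - eta > 0" using that(2) by linarith
    ultimately show ?thesis by blast
  qed
  let ?L = "if s - eta > 0 then T (s - eta) else {}"
  have "?E \<subseteq> T (s + eta) \<union> ?L"
  proof
    fix a assume a: "a \<in> ?E"
    then have aP: "a \<in> ?P" and "\<bar>sqrt (?c a / real k) - s\<bar> > eta" by blast+
    then have "sqrt (?c a / real k) - s > eta \<or> s - sqrt (?c a / real k) > eta" by linarith
    then show "a \<in> T (s + eta) \<union> ?L"
    proof
      assume "sqrt (?c a / real k) - s > eta"
      then show ?thesis using up[OF aP] by blast
    next
      assume "s - sqrt (?c a / real k) > eta"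
      then show ?thesis using low[OF aP] by simp
    qed
  qed
  moreover have "finite (T (s + eta) \<union> ?L)" using finP by (simp add: T_def)
  ultimately have "card ?E \<le> card (T (s + eta) \<union> ?L)" by (intro card_mono)
  also have "\<dots> \<le> card (T (s + eta)) + card ?L" by (rule card_Un_le)
  finally have "real (card ?E) \<le> real (card (T (s + eta))) + real (card ?L)" by linarith
  also have "\<dots> \<le> exp (- real k * eta\<^sup>2) * real (card A) ^ k + exp (- real k * eta\<^sup>2) * real (card A) ^ k"
    using tail[of "s + eta"] tail[of "s - eta"] s0 eta by (intro add_mono) auto
  finally have "real (card ?E) \<le> 2 * exp (- real k * eta\<^sup>2) * real (card A) ^ k" by linarith
  then show ?thesis using False unfolding s_def[symmetric] if_not_P[OF False] by (simp only: mult.assoc)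
qed

section \<open>Almost periods of a convolution\<close>
definition in_residues :: "nat \<Rightarrow> int set \<Rightarrow> int \<Rightarrow> bool" where
  "in_residues N B x \<longleftrightarrow> (\<exists>b\<in>B. int N dvd x - b)"

text \<open>The convolution of the uniform probability measure on \<open>A\<close> with the indicator function of
  \<open>B\<close>, both read modulo \<open>N\<close>.\<close>
definition conv :: "nat \<Rightarrow> int set \<Rightarrow> int set \<Rightarrow> int \<Rightarrow> real" where
  "conv N A B x = real (card {a \<in> A. in_residues N B (x - a)}) / real (card A)"

lemma in_residues_cong: "int N dvd x - y \<Longrightarrow> in_residues N B x = in_residues N B y"
proof -
  assume a: "int N dvd x - y"
  have "int N dvd x - b \<longleftrightarrow> int N dvd y - b" for b
    using dvd_add_right_iff[OF a, of "y - b"] by simp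
  then show ?thesis by (simp add: in_residues_def)
qed

lemma conv_cong: "int N dvd x - y \<Longrightarrow> conv N A B x = conv N A B y"
proof -
  assume "int N dvd x - y"
  then have "in_residues N B (x - a) = in_residues N B (y - a)" for a
    by (intro in_residues_cong) simp
  then show ?thesis by (simp add: conv_def)
qed

lemma conv_nonneg: "conv N A B x \<ge> 0" by (simp add: conv_def)

lemma conv_le_1: "finite A \<Longrightarrow> conv N A B x \<le> 1"
  by (cases "A = {}") (auto simp: conv_def divide_le_eq card_gt_0_iff intro!: card_mono)

lemma conv_pos_iff: "finite A \<Longrightarrow> conv N A B x \<noteq> 0 \<longleftrightarrow> (\<exists>a\<in>A. \<exists>b\<in>B. int N dvd x - a - b)"
  by (auto simp: conv_def in_residues_def card_eq_0_iff)

lemma card_conv_support: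
  assumes "finite A" "finite B" "N > 0"
  shows "card {x \<in> {0..<int N}. conv N A B x \<noteq> 0} \<le> card (A + B)"
proof -
  have "{x \<in> {0..<int N}. conv N A B x \<noteq> 0} \<subseteq> (\<lambda>x. x mod int N) ` (A + B)"
  proof
    fix x assume x: "x \<in> {x \<in> {0..<int N}. conv N A B x \<noteq> 0}"
    then obtain a b where ab: "a \<in> A" "b \<in> B" "int N dvd x - (a + b)"
      using assms conv_pos_iff by (auto simp: algebra_simps)
    then have "x mod int N = (a + b) mod int N" by (simp add: mod_eq_dvd_iff)
    then show "x \<in> (\<lambda>x. x mod int N) ` (A + B)" using x ab by (intro image_eqI[of _ _ "a + b"]) auto
  qed
  then have "card {x \<in> {0..<int N}. conv N A B x \<noteq> 0} \<le> card ((\<lambda>x. x mod int N) ` (A + B))"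
    using assms by (intro card_mono) (auto intro: finite_set_plus)
  also have "\<dots> \<le> card (A + B)" using assms by (intro card_image_le finite_set_plus)
  finally show ?thesis .
qed

lemma pigeonhole_fibre:
  assumes "finite X" "finite Y" "h ` X \<subseteq> Y" "Y \<noteq> {}"
  obtains y where "y \<in> Y" "card X \<le> card Y * card {x \<in> X. h x = y}"
proof -
  have sum: "card X = (\<Sum>y\<in>Y. card {x \<in> X. h x = y})"
    using assms by (subst card_eq_sum, subst sum.group[of X Y h, symmetric]) auto
  have "\<not> (\<forall>y\<in>Y. card Y * card {x \<in> X. h x = y} < card X)"
  proof
    assume a: "\<forall>y\<in>Y. card Y * card {x \<in> X. h x = y} < card X"
    have "(\<Sum>y\<in>Y. card Y * card {x \<in> X. h x = y}) < (\<Sum>y\<in>Y. card X)"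
      using a assms by (intro sum_strict_mono) auto
    then show False using sum by (simp flip: sum_distrib_left)
  qed
  then obtain y where "y \<in> Y" "\<not> card Y * card {x \<in> X. h x = y} < card X" by blast
  then show ?thesis using that[of y] by simp
qed

text \<open>The Croot--Sisask argument. On average a tuple from \<open>A\<close> approximates the convolution badly at
  few points, so at least half of the tuples are good. If the tuple \<open>z\<close> is the diagonal translate by \<open>b\<close>
  of a good tuple, then the sample \<open>F\<close> taken along \<open>z\<close>, shifted by \<open>b\<close>, approximates the
  convolution; two such \<open>b\<close> for the same \<open>z\<close> differ by an almost period.\<close>
lemma almost_periods:
  fixes A B :: "int set" and K eta :: real and N k :: nat
  defines "n \<equiv> real (card (A + B))"
  assumes fin: "finite A" "finite B" and ne: "A \<noteq> {}" "B \<noteq> {}"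
    and K: "real (card (A + B)) \<le> K * real (card A)" and k: "k > 0" and eta: "eta > 0"
    and N: "N > 0"
  obtains T F where "T \<subseteq> B" "real (card B) \<le> 2 * K ^ k * real (card T)"
    "\<And>x y. int N dvd x - y \<Longrightarrow> F x = F y"
    "\<And>b. b \<in> T \<Longrightarrow> real (card {x \<in> {0..<int N}. \<bar>sqrt (F (x + b)) - sqrt (conv N A B x)\<bar> > eta})
       \<le> 4 * exp (- real k * eta\<^sup>2) * n"
proof -
  let ?P = "{..<k} \<rightarrow>\<^sub>E A"
  define s where "s a x = real (card {i \<in> {..<k}. in_residues N B (x - a i)}) / real k" for a x
  define bad where "bad a x \<longleftrightarrow> \<bar>sqrt (s a x) - sqrt (conv N A B x)\<bar> > eta" for a x
  define g where "g = 2 * exp (- real k * eta\<^sup>2)"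
  have g0: "g > 0" by (simp add: g_def)
  have finP: "finite ?P" using fin by (intro finite_PiE) auto
  have cP: "card ?P = card A ^ k" using fin by (simp add: card_PiE)
  have cA: "card A > 0" using fin ne by (simp add: card_gt_0_iff)
  have n0: "n > 0" using fin ne by (auto simp: n_def card_gt_0_iff intro!: finite_set_plus)
  have tail: "real (card {a \<in> ?P. bad a x}) \<le> (if conv N A B x = 0 then 0 else g * real (card A) ^ k)" for x
  proof -
    let ?S = "{a \<in> A. in_residues N B (x - a)}"
    have e: "{i \<in> {..<k}. in_residues N B (x - a i)} = {i \<in> {..<k}. a i \<in> ?S}" if "a \<in> ?P" for a
      using that by auto
    have eq: "{a \<in> ?P. bad a x} = {a \<in> ?P. \<bar>sqrt (real (card {i \<in> {..<k}. a i \<in> ?S}) / real k)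
        - sqrt (real (card ?S) / real (card A))\<bar> > eta}"
      by (intro Collect_cong conj_cong refl) (simp only: bad_def s_def conv_def e)
    moreover have "(?S = {}) = (conv N A B x = 0)" using fin by (auto simp: conv_def card_eq_0_iff)
    moreover have "real (card {a \<in> ?P. bad a x})
        \<le> (if ?S = {} then 0 else 2 * exp (- real k * eta\<^sup>2) * real (card A) ^ k)"
      unfolding eq by (rule sampling_tail) (use fin k eta in auto)
    ultimately show ?thesis by (simp only: g_def)
  qed
  let ?b = "\<lambda>a. card {x \<in> {0..<int N}. bad a x}"
  define Good where "Good = {a \<in> ?P. real (?b a) \<le> 2 * g * n}"
  have "(\<Sum>a\<in>?P. ?b a) = (\<Sum>x\<in>{0..<int N}. card {a \<in> ?P. bad a x})"
    by (rule sum_multicount_gen) (use finP in auto)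
  then have "(\<Sum>a\<in>?P. real (?b a)) = (\<Sum>x\<in>{0..<int N}. real (card {a \<in> ?P. bad a x}))"
    by (simp only: of_nat_sum[symmetric])
  also have "\<dots> \<le> (\<Sum>x\<in>{0..<int N}. if conv N A B x = 0 then 0 else g * real (card A) ^ k)"
    by (intro sum_mono tail)
  also have "\<dots> = real (card {x \<in> {0..<int N}. conv N A B x \<noteq> 0}) * (g * real (card A) ^ k)"
    by (simp add: sum.If_cases Int_def Collect_neg_eq[symmetric] Compl_eq)
  also have "\<dots> \<le> n * (g * real (card A) ^ k)"
    using card_conv_support[OF fin N] g0 by (intro mult_right_mono) (auto simp: n_def)
  finally have tot: "(\<Sum>a\<in>?P. real (?b a)) \<le> n * g * real (card A) ^ k" by (simp add: mult.assoc)
  have "2 * g * n * real (card (?P - Good)) = (\<Sum>a\<in>?P - Good. 2 * g * n)" by simp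
  also have "\<dots> \<le> (\<Sum>a\<in>?P - Good. real (?b a))"
  proof (rule sum_mono)
    fix a assume "a \<in> ?P - Good"
    then have "\<not> real (?b a) \<le> 2 * g * n" unfolding Good_def by blast
    then show "2 * g * n \<le> real (?b a)" by linarith
  qed
  also have "\<dots> \<le> (\<Sum>a\<in>?P. real (?b a))" using finP by (intro sum_mono2) auto
  also note tot
  finally have "n * g * (2 * real (card (?P - Good))) \<le> n * g * real (card A) ^ k" by (simp add: mult_ac)
  then have "2 * real (card (?P - Good)) \<le> real (card A) ^ k" using n0 g0 by simp
  moreover have GP: "Good \<subseteq> ?P" by (auto simp: Good_def)
  moreover have "real (card (?P - Good)) = real (card A) ^ k - real (card Good)"
    using GP finP card_mono[OF finP GP] by (simp add: card_Diff_subset finite_subset of_nat_diff cP)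
  ultimately have Good: "real (card A) ^ k \<le> 2 * real (card Good)" by linarith
  have finG: "finite Good" using GP finP finite_subset by blast
  \<comment> \<open>Translating a tuple from \<open>A\<close> along the diagonal by some \<open>b \<in> B\<close> lands in the small set of
    tuples from \<open>A + B\<close>, so some tuple arises from many pairs.\<close>
  define h where "h = (\<lambda>(b, a). \<lambda>i\<in>{..<k}. a i + b :: int)"
  let ?Q = "{..<k} \<rightarrow>\<^sub>E A + B"
  have "h ` (B \<times> Good) \<subseteq> ?Q"
  proof
    fix f assume "f \<in> h ` (B \<times> Good)"
    then obtain b a where f: "b \<in> B" "a \<in> ?P" "f = (\<lambda>i\<in>{..<k}. a i + b)"
      using GP by (auto simp: h_def)
    then show "f \<in> ?Q" by (auto intro!: restrict_PiE_iff[THEN iffD2])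
  qed
  moreover have "?Q \<noteq> {}" using ne by (auto simp: PiE_eq_empty_iff set_plus_def)
  moreover have "finite ?Q"
    using finite_set_plus[OF fin] by (intro finite_PiE) simp_all
  moreover have "finite (B \<times> Good)" using fin finG by simp
  ultimately obtain z where z: "z \<in> ?Q" "card (B \<times> Good) \<le> card ?Q * card {p \<in> B \<times> Good. h p = z}"
    using pigeonhole_fibre[of "B \<times> Good" ?Q h] by blast
  define T where "T = {b \<in> B. \<exists>a\<in>Good. h (b, a) = z}"
  have finT: "finite T" using fin by (simp add: T_def)
  have "inj_on fst {p \<in> B \<times> Good. h p = z}"
  proof (rule inj_onI)
    fix p p' assume p: "p \<in> {p \<in> B \<times> Good. h p = z}" "p' \<in> {p \<in> B \<times> Good. h p = z}" "fst p = fst p'"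
    obtain b a b' a' where e: "p = (b, a)" "p' = (b', a')" by fastforce
    have b: "b = b'" using p(3) e by simp
    have aP: "a \<in> ?P" "a' \<in> ?P" using p GP e by auto
    have hp: "h p = h p'" using p by simp
    have "a i = a' i" if "i < k" for i using that fun_cong[OF hp, of i] by (simp add: h_def e b)
    then have "a = a'" using aP by (intro PiE_ext[of a "{..<k}" "\<lambda>_. A"]) auto
    then show "p = p'" using e b by simp
  qed
  then have "card {p \<in> B \<times> Good. h p = z} \<le> card T"
    using finT by (intro card_inj_on_le[of fst]) (auto simp: T_def)
  then have "card (B \<times> Good) \<le> card ?Q * card T" using z(2) by (meson le_trans mult_le_mono2)
  moreover have "card ?Q = card (A + B) ^ k" by (simp add: card_PiE)
  ultimately have "card B * card Good \<le> card (A + B) ^ k * card T"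
    by (simp only: card_cartesian_product)
  then have "real (card B * card Good) \<le> real (card (A + B) ^ k * card T)"
    by (simp only: of_nat_le_iff)
  then have "real (card B) * real (card Good) \<le> n ^ k * real (card T)"
    by (simp add: n_def)
  also have "\<dots> \<le> (K * real (card A)) ^ k * real (card T)"
    using K n0 by (intro mult_right_mono power_mono) (auto simp: n_def)
  finally have c: "real (card B) * real (card Good) \<le> K ^ k * real (card A) ^ k * real (card T)"
    by (simp add: power_mult_distrib)
  have "real (card B) * real (card A) ^ k \<le> 2 * (real (card B) * real (card Good))"
    using mult_left_mono[OF Good, of "real (card B)"] by (simp add: mult_ac)
  also have "\<dots> \<le> 2 * (K ^ k * real (card A) ^ k * real (card T))" using c by linarith
  finally have "real (card B) * real (card A) ^ k \<le> (2 * K ^ k * real (card T)) * real (card A) ^ k"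
    by (simp add: mult_ac)
  then have size: "real (card B) \<le> 2 * K ^ k * real (card T)" using cA by simp
  show ?thesis
  proof (rule that[of T "s z"])
    show "T \<subseteq> B" by (auto simp: T_def)
    show "real (card B) \<le> 2 * K ^ k * real (card T)" by (rule size)
    fix x y assume xy: "int N dvd x - y"
    have "in_residues N B (x - z i) = in_residues N B (y - z i)" for i
      using xy by (intro in_residues_cong) simp
    then show "s z x = s z y" by (simp add: s_def)
  next
    fix b assume "b \<in> T"
    then obtain a where a: "a \<in> Good" "h (b, a) = z" by (auto simp: T_def)
    have "s z (x + b) = s a x" for x
    proof -
      have "{i \<in> {..<k}. in_residues N B (x + b - z i)} = {i \<in> {..<k}. in_residues N B (x - a i)}"
        unfolding a(2)[symmetric] by (auto simp: h_def)
      then show ?thesis by (simp only: s_def)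
    qed
    then show "real (card {x \<in> {0..<int N}. \<bar>sqrt (s z (x + b)) - sqrt (conv N A B x)\<bar> > eta})
       \<le> 4 * exp (- real k * eta\<^sup>2) * n"
      using a(1) by (simp add: Good_def bad_def g_def)
  qed
qed

section \<open>Fourier analysis modulo \<open>N\<close>\<close>
text \<open>The additive character \<open>e(x / N)\<close>. Residues are represented by arbitrary integers; functions
  on the cyclic group are \<open>N\<close>-periodic functions on the integers.\<close>
definition ec :: "nat \<Rightarrow> int \<Rightarrow> complex" where
  "ec N x = cis (2 * pi * real_of_int x / real N)"

lemma norm_ec [simp]: "norm (ec N x) = 1" by (simp add: ec_def)

lemma ec_0 [simp]: "ec N 0 = 1" by (simp add: ec_def)

lemma ec_add: "ec N (x + y) = ec N x * ec N y"
  by (simp add: ec_def cis_mult add_divide_distrib distrib_left)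

lemma ec_minus: "ec N (- x) = cnj (ec N x)"
  by (simp add: ec_def cis_cnj)

lemma ec_diff: "ec N (x - y) = ec N x * cnj (ec N y)"
  using ec_add[of N x "- y"] by (simp add: ec_minus)

lemma ec_sum: "ec N (\<Sum>i\<in>I. f i) = (\<Prod>i\<in>I. ec N (f i))"
  by (induction I rule: infinite_finite_induct) (auto simp: ec_add)

lemma ec_of_nat_mult: "ec N (int j * x) = ec N x ^ j"
  by (induction j) (auto simp: ec_add distrib_right)

lemma ec_eq_1_iff:
  assumes "N > 0"
  shows "ec N x = 1 \<longleftrightarrow> int N dvd x"
proof
  assume "ec N x = 1"
  then have "cos (2 * pi * real_of_int x / real N) = 1" by (metis cis.sel(1) ec_def one_complex.sel(1))
  then obtain j :: int where "2 * pi * real_of_int x / real N = real_of_int j * 2 * pi"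
    by (auto simp: cos_one_2pi_int)
  then have "real_of_int x = real_of_int (j * int N)" using assms by (simp add: field_simps)
  then have "x = j * int N" by (simp only: of_int_eq_iff)
  then show "int N dvd x" by simp
next
  assume "int N dvd x"
  then obtain j where "x = int N * j" by (auto elim: dvdE)
  then have "ec N x = cis (2 * pi * real_of_int j)" using assms by (simp add: ec_def field_simps)
  then show "ec N x = 1" by (simp add: cis_multiple_2pi)
qed

lemma ec_cong:
  assumes "N > 0" "int N dvd x - y"
  shows "ec N x = ec N y"
proof -
  have "ec N x = ec N (x - y) * ec N y" by (simp flip: ec_add)
  then show ?thesis using ec_eq_1_iff[OF assms(1), of "x - y"] assms(2) by simp
qed

lemma sum_ec:
  assumes "N > 0"
  shows "(\<Sum>r\<in>{0..<int N}. ec N (r * x)) = (if int N dvd x then of_nat N else 0)"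
proof -
  have "{0..<int N} = int ` {..<N}"
    by (simp add: image_int_atLeastLessThan lessThan_atLeast0)
  then have "(\<Sum>r\<in>{0..<int N}. ec N (r * x)) = (\<Sum>r<N. ec N x ^ r)"
    by (simp add: sum.reindex ec_of_nat_mult)
  also have "\<dots> = (if int N dvd x then of_nat N else 0)"
  proof (cases "int N dvd x")
    case True
    then show ?thesis using ec_eq_1_iff[OF assms, of x] by simp
  next
    case False
    then have "ec N x \<noteq> 1" using ec_eq_1_iff[OF assms, of x] by simp
    moreover have "ec N x ^ N = 1"
      using ec_eq_1_iff[OF assms, of "int N * x"] by (simp add: ec_of_nat_mult)
    ultimately show ?thesis using False by (simp add: geometric_sum)
  qed
  finally show ?thesis .
qed

lemma norm_cis_minus_1_le: "norm (cis u - 1) \<le> \<bar>u\<bar>"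
proof -
  have "(norm (cis u - 1))\<^sup>2 = 2 - 2 * cos (2 * (u / 2))"
    using sin_cos_squared_add[of u]
    by (simp add: cmod_def power2_eq_square algebra_simps)
  also have "\<dots> = 4 * (sin (u / 2))\<^sup>2" by (simp only: cos_double_sin) simp
  also have "\<dots> \<le> 4 * (\<bar>u / 2\<bar>)\<^sup>2"
    using power_mono[OF abs_sin_x_le_abs_x[of "u / 2"], of 2] by simp
  also have "\<dots> = \<bar>u\<bar>\<^sup>2" by (simp add: power2_eq_square)
  finally show ?thesis by (rule power2_le_imp_le) simp
qed

lemma norm_ec_minus_1_add: "norm (ec N (x + y) - 1) \<le> norm (ec N x - 1) + norm (ec N y - 1)"
proof -
  have "ec N (x + y) - 1 = ec N x * (ec N y - 1) + (ec N x - 1)" by (simp add: ec_add algebra_simps)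
  then have "norm (ec N (x + y) - 1) \<le> norm (ec N x * (ec N y - 1)) + norm (ec N x - 1)"
    by (metis norm_triangle_ineq)
  then show ?thesis by (simp add: norm_mult)
qed

lemma norm_ec_minus_1_minus: "norm (ec N (- x) - 1) = norm (ec N x - 1)"
  by (metis complex_cnj_diff complex_cnj_one complex_mod_cnj ec_minus)

lemma norm_ec_minus_1_sum:
  "norm (ec N (\<Sum>i\<in>I. f i) - 1) \<le> (\<Sum>i\<in>I. norm (ec N (f i) - 1))"
proof (induction I rule: infinite_finite_induct)
  case (insert i I)
  then show ?case using norm_ec_minus_1_add[of N "f i" "\<Sum>i\<in>I. f i"] by simp
qed auto

lemma norm_ec_minus_1_mult: "norm (ec N (int j * x) - 1) \<le> real j * norm (ec N x - 1)"
  using norm_ec_minus_1_sum[of N "\<lambda>_. x" "{..<j}"] by simp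

definition ft :: "nat \<Rightarrow> int set \<Rightarrow> int \<Rightarrow> complex" where
  "ft N S r = (\<Sum>s\<in>S. ec N (r * s))"

lemma norm_ft_minus: "norm (ft N S (- r)) = norm (ft N S r)"
proof -
  have "ft N S (- r) = cnj (ft N S r)" by (simp add: ft_def ec_minus)
  then show ?thesis by simp
qed

lemma norm_ft_le: "norm (ft N S r) \<le> real (card S)"
  unfolding ft_def by (rule order_trans[OF norm_sum]) simp

lemma parseval:
  assumes "N > 0" "finite S" "inj_on (\<lambda>x. x mod int N) S"
  shows "(\<Sum>r\<in>{0..<int N}. (norm (ft N S r))\<^sup>2) = real N * real (card S)"
proof -
  have "complex_of_real (\<Sum>r\<in>{0..<int N}. (norm (ft N S r))\<^sup>2)
      = (\<Sum>r\<in>{0..<int N}. ft N S r * cnj (ft N S r))"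
    by (simp only: of_real_sum complex_norm_square)
  also have "\<dots> = (\<Sum>r\<in>{0..<int N}. \<Sum>s\<in>S. \<Sum>s'\<in>S. ec N (r * (s - s')))"
    by (simp add: ft_def sum_product ec_diff right_diff_distrib)
  also have "\<dots> = (\<Sum>s\<in>S. \<Sum>s'\<in>S. \<Sum>r\<in>{0..<int N}. ec N (r * (s - s')))"
    by (rule trans[OF sum.swap], rule sum.cong[OF refl], rule sum.swap)
  also have "\<dots> = (\<Sum>s\<in>S. \<Sum>s'\<in>S. if s = s' then of_nat N else 0)"
  proof (intro sum.cong refl)
    fix s s' assume "s \<in> S" "s' \<in> S"
    then have "int N dvd s - s' \<longleftrightarrow> s = s'"
      using assms(3) by (auto simp: inj_on_def mod_eq_dvd_iff)
    then show "(\<Sum>r\<in>{0..<int N}. ec N (r * (s - s'))) = (if s = s' then of_nat N else 0)"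
      by (simp add: sum_ec[OF assms(1)])
  qed
  also have "\<dots> = complex_of_real (real N * real (card S))"
    using assms(2) by (simp add: sum.delta)
  finally show ?thesis by (simp only: of_real_eq_iff)
qed

lemma conv_fourier:
  assumes "N > 0" "finite A" "finite B" "A \<noteq> {}" "inj_on (\<lambda>x. x mod int N) B"
  shows "of_real (real N * real (card A) * conv N A B x)
    = (\<Sum>r\<in>{0..<int N}. ec N (r * x) * ft N A (- r) * ft N B (- r))"
proof -
  have cA: "card A > 0" using assms by (simp add: card_gt_0_iff)
  have one: "(\<Sum>b\<in>B. if int N dvd y - b then of_nat N else 0)
      = (if in_residues N B y then of_nat N else (0::complex))" for y
  proof (cases "in_residues N B y")
    case True
    then obtain b where b: "b \<in> B" "int N dvd y - b" by (auto simp: in_residues_def)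
    have "int N dvd y - b' \<longleftrightarrow> b' = b" if "b' \<in> B" for b'
    proof
      assume "int N dvd y - b'"
      with b(2) have "int N dvd (y - b) - (y - b')" by (rule dvd_diff)
      then have "b' mod int N = b mod int N" by (simp add: mod_eq_dvd_iff)
      then show "b' = b" using assms(5) that b by (auto dest: inj_onD)
    qed (use b in simp)
    then have "(\<Sum>b\<in>B. if int N dvd y - b then of_nat N else 0) = (\<Sum>b'\<in>B. if b' = b then of_nat N else (0::complex))"
      by (intro sum.cong) auto
    then show ?thesis using True b assms by (simp add: sum.delta)
  qed (auto simp: in_residues_def intro!: sum.neutral)
  have "(\<Sum>r\<in>{0..<int N}. ec N (r * x) * ft N A (- r) * ft N B (- r))
      = (\<Sum>r\<in>{0..<int N}. \<Sum>a\<in>A. \<Sum>b\<in>B. ec N (r * (x - a - b)))"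
  proof (rule sum.cong[OF refl])
    fix r
    have "ec N (r * x) * ft N A (- r) * ft N B (- r)
        = ec N (r * x) * (\<Sum>a\<in>A. \<Sum>b\<in>B. ec N (- r * a) * ec N (- r * b))"
      by (simp only: mult.assoc ft_def sum_product)
    also have "\<dots> = (\<Sum>a\<in>A. \<Sum>b\<in>B. ec N (r * x + (- r * a + - r * b)))"
      by (simp only: sum_distrib_left ec_add)
    also have "\<dots> = (\<Sum>a\<in>A. \<Sum>b\<in>B. ec N (r * (x - a - b)))"
      by (intro sum.cong refl arg_cong[of _ _ "ec N"]) (simp add: algebra_simps)
    finally show "ec N (r * x) * ft N A (- r) * ft N B (- r)
        = (\<Sum>a\<in>A. \<Sum>b\<in>B. ec N (r * (x - a - b)))" .
  qed
  also have "\<dots> = (\<Sum>a\<in>A. \<Sum>b\<in>B. \<Sum>r\<in>{0..<int N}. ec N (r * (x - a - b)))"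
    by (rule trans[OF sum.swap], rule sum.cong[OF refl], rule sum.swap)
  also have "\<dots> = (\<Sum>a\<in>A. \<Sum>b\<in>B. if int N dvd (x - a) - b then of_nat N else 0)"
    by (simp add: sum_ec[OF assms(1)])
  also have "\<dots> = (\<Sum>a\<in>A. if in_residues N B (x - a) then of_nat N else 0)"
    by (simp only: one)
  also have "\<dots> = of_real (real N * real (card {a \<in> A. in_residues N B (x - a)}))"
    using assms(2) by (simp add: sum.If_cases Int_def)
  finally show ?thesis using cA by (simp add: conv_def)
qed

text \<open>A pair of \<open>m\<close>-tuples \<open>(u, v)\<close> from \<open>T\<close> is regarded as a walk with steps \<open>u j - v j\<close>. Averaging
  over walks is convolution with the \<open>m\<close>-fold power of the difference measure of \<open>T\<close>, whose Fourier
  coefficients are nonnegative.\<close>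
definition walks :: "nat \<Rightarrow> int set \<Rightarrow> ((nat \<Rightarrow> int) \<times> (nat \<Rightarrow> int)) set" where
  "walks m T = ({..<m} \<rightarrow>\<^sub>E T) \<times> ({..<m} \<rightarrow>\<^sub>E T)"

definition endpoint :: "nat \<Rightarrow> (nat \<Rightarrow> int) \<times> (nat \<Rightarrow> int) \<Rightarrow> int" where
  "endpoint m w = (\<Sum>j<m. fst w j - snd w j)"

lemma finite_walks: "finite T \<Longrightarrow> finite (walks m T)"
  unfolding walks_def by (intro finite_cartesian_product finite_PiE) auto

lemma card_walks: "card (walks m T) = card T ^ (2 * m)"
  by (simp add: walks_def card_cartesian_product card_PiE power_add mult_2)

lemma sum_ec_walks:
  assumes "finite T"
  shows "(\<Sum>w\<in>walks m T. ec N (r * endpoint m w)) = of_real (norm (ft N T r) ^ (2 * m))"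
proof -
  have one: "(\<Sum>u\<in>{..<m} \<rightarrow>\<^sub>E T. \<Prod>j<m. ec N (r * u j)) = ft N T r ^ m"
    using prod_sum_PiE[of "{..<m}" "\<lambda>_. T" "\<lambda>_ y. ec N (r * y)"] assms by (simp add: ft_def)
  have "(\<Sum>w\<in>walks m T. ec N (r * endpoint m w))
      = (\<Sum>u\<in>{..<m} \<rightarrow>\<^sub>E T. \<Sum>v\<in>{..<m} \<rightarrow>\<^sub>E T. (\<Prod>j<m. ec N (r * u j)) * cnj (\<Prod>j<m. ec N (r * v j)))"
    by (simp add: walks_def sum.cartesian_product endpoint_def sum_distrib_left ec_sum
        right_diff_distrib ec_diff prod.distrib case_prod_unfold)
  also have "\<dots> = ft N T r ^ m * cnj (ft N T r ^ m)"
    by (simp only: sum_product[symmetric] cnj_sum[symmetric] one)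
  also have "\<dots> = (ft N T r * cnj (ft N T r)) ^ m" by (simp add: power_mult_distrib)
  also have "\<dots> = of_real (norm (ft N T r) ^ (2 * m))"
    by (simp add: power_mult flip: complex_norm_square)
  finally show ?thesis .
qed

definition smooth :: "nat \<Rightarrow> int set \<Rightarrow> (int \<Rightarrow> real) \<Rightarrow> int \<Rightarrow> real" where
  "smooth m T f x = (\<Sum>w\<in>walks m T. f (x + endpoint m w)) / real (card (walks m T))"

text \<open>In the Fourier expansion of the difference, the factors from the walk and from the shift are
  controlled uniformly by \<open>eps\<close>, and Parseval's identity bounds the sum of \<open>|ft A| |ft B|\<close> that
  remains.\<close>
lemma smooth_conv_close:
  fixes A B T :: "int set" and eps :: real
  assumes N: "N > 0" and fin: "finite A" "finite B" "finite T"
    and ne: "A \<noteq> {}" "B \<noteq> {}" "T \<noteq> {}"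
    and inj: "inj_on (\<lambda>x. x mod int N) A" "inj_on (\<lambda>x. x mod int N) B"
    and eps: "\<And>r. r \<in> {0..<int N} \<Longrightarrow>
      (norm (ft N T r) / real (card T)) ^ (2 * m) * norm (ec N (r * t) - 1) \<le> eps"
  shows "\<bar>smooth m T (conv N A B) (x + t) - smooth m T (conv N A B) x\<bar>
    \<le> eps * sqrt (real (card B) / real (card A))"
proof -
  let ?g = "smooth m T (conv N A B)"
  have c: "real (card A) > 0" "real (card B) > 0" "real (card T) > 0" using fin ne by (auto simp: card_gt_0_iff)
  define M where "M = real (card T) ^ (2 * m)"
  have M: "M > 0" using c by (simp add: M_def)
  define al where "al = sqrt (real (card B) / real (card A))"
  have al: "al > 0" "al\<^sup>2 = real (card B) / real (card A)" using c by (auto simp: al_def)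
  have four: "of_real (real N * real (card A) * M * ?g y)
      = (\<Sum>r\<in>{0..<int N}. ec N (r * y) * ft N A (- r) * ft N B (- r) * of_real (norm (ft N T r) ^ (2 * m)))"
    for y
  proof -
    have "M * ?g y = (\<Sum>w\<in>walks m T. conv N A B (y + endpoint m w))"
      using M by (simp add: smooth_def card_walks M_def)
    then have "real N * real (card A) * M * ?g y
        = (\<Sum>w\<in>walks m T. real N * real (card A) * conv N A B (y + endpoint m w))"
      by (simp only: sum_distrib_left[symmetric] mult.assoc)
    then have "of_real (real N * real (card A) * M * ?g y)
        = (\<Sum>w\<in>walks m T. complex_of_real (real N * real (card A) * conv N A B (y + endpoint m w)))"
      by (simp only: of_real_sum)
    also have "\<dots> = (\<Sum>w\<in>walks m T. \<Sum>r\<in>{0..<int N}.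
        ec N (r * (y + endpoint m w)) * ft N A (- r) * ft N B (- r))"
      by (simp only: conv_fourier[OF N fin(1,2) ne(1) inj(2)])
    also have "\<dots> = (\<Sum>r\<in>{0..<int N}. \<Sum>w\<in>walks m T.
        ec N (r * y) * ft N A (- r) * ft N B (- r) * ec N (r * endpoint m w))"
      by (subst sum.swap) (simp add: distrib_left ec_add mult_ac)
    also have "\<dots> = (\<Sum>r\<in>{0..<int N}. ec N (r * y) * ft N A (- r) * ft N B (- r)
        * of_real (norm (ft N T r) ^ (2 * m)))"
      by (simp only: sum_distrib_left[symmetric] sum_ec_walks[OF fin(3)])
    finally show ?thesis .
  qed
  have "complex_of_real (real N * real (card A) * M * (?g (x + t) - ?g x))
      = (\<Sum>r\<in>{0..<int N}. ec N (r * x) * ft N A (- r) * ft N B (- r)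
          * of_real (norm (ft N T r) ^ (2 * m)) * (ec N (r * t) - 1))"
    unfolding right_diff_distrib of_real_diff four sum_subtractf[symmetric]
    by (intro sum.cong refl) (simp add: ec_add algebra_simps)
  then have "norm (complex_of_real (real N * real (card A) * M * (?g (x + t) - ?g x)))
      \<le> (\<Sum>r\<in>{0..<int N}. norm (ec N (r * x) * ft N A (- r) * ft N B (- r)
          * of_real (norm (ft N T r) ^ (2 * m)) * (ec N (r * t) - 1)))"
    by (simp only: norm_sum)
  also have "\<dots> \<le> (\<Sum>r\<in>{0..<int N}. M * eps * ((al * (norm (ft N A r))\<^sup>2 + (norm (ft N B r))\<^sup>2 / al) / 2))"
  proof (rule sum_mono)
    fix r assume r: "r \<in> {0..<int N}"
    let ?a = "norm (ft N A r)" and ?b = "norm (ft N B r)"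
    \<comment> \<open>The weight \<open>al\<close> balances the sums over \<open>A\<close> and \<open>B\<close>, as in Cauchy--Schwarz.\<close>
    have "0 \<le> (al * ?a - ?b)\<^sup>2" by simp
    then have ab: "?a * ?b \<le> (al * ?a\<^sup>2 + ?b\<^sup>2 / al) / 2"
      using al(1) by (simp add: field_simps power2_eq_square)
    have e: "norm (ft N T r) ^ (2 * m) * norm (ec N (r * t) - 1) \<le> M * eps"
      using mult_left_mono[OF eps[OF r], of M] M c by (simp add: M_def power_divide)
    have e0: "M * eps \<ge> 0" by (rule order_trans[OF _ e]) simp
    have "norm (ec N (r * x) * ft N A (- r) * ft N B (- r)
          * of_real (norm (ft N T r) ^ (2 * m)) * (ec N (r * t) - 1))
        = (?a * ?b) * (norm (ft N T r) ^ (2 * m) * norm (ec N (r * t) - 1))"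
      by (simp add: norm_mult norm_ft_minus norm_power)
    also have "\<dots> \<le> (?a * ?b) * (M * eps)" by (intro mult_left_mono e) auto
    also have "\<dots> \<le> ((al * ?a\<^sup>2 + ?b\<^sup>2 / al) / 2) * (M * eps)" by (intro mult_right_mono ab e0)
    finally show "norm (ec N (r * x) * ft N A (- r) * ft N B (- r)
          * of_real (norm (ft N T r) ^ (2 * m)) * (ec N (r * t) - 1))
        \<le> M * eps * ((al * ?a\<^sup>2 + ?b\<^sup>2 / al) / 2)" by (simp add: mult.commute)
  qed
  also have "\<dots> = M * eps * ((\<Sum>r\<in>{0..<int N}. al * (norm (ft N A r))\<^sup>2 + (norm (ft N B r))\<^sup>2 / al) / 2)"
    by (simp only: sum_distrib_left sum_divide_distrib)
  also have "\<dots> = M * eps * ((al * (\<Sum>r\<in>{0..<int N}. (norm (ft N A r))\<^sup>2)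
      + (\<Sum>r\<in>{0..<int N}. (norm (ft N B r))\<^sup>2) / al) / 2)"
    by (simp only: sum_distrib_left sum_divide_distrib sum.distrib)
  also have "\<dots> = M * eps * ((al * (real N * real (card A)) + real N * real (card B) / al) / 2)"
    by (simp only: parseval[OF N fin(1) inj(1)] parseval[OF N fin(2) inj(2)])
  also have "real (card B) = al\<^sup>2 * real (card A)" using al(2) c by simp
  also have "M * eps * ((al * (real N * real (card A)) + real N * (al\<^sup>2 * real (card A)) / al) / 2)
      = real N * real (card A) * M * (eps * al)"
    using al(1) by (simp add: power2_eq_square)
  finally have "real N * real (card A) * M * \<bar>?g (x + t) - ?g x\<bar> \<le> real N * real (card A) * M * (eps * al)"
    using M by (simp only: norm_of_real abs_mult abs_of_nat abs_of_pos)
  then show ?thesis using N c M by (simp add: al_def)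
qed

section \<open>Chang's theorem and simultaneous approximation\<close>
definition dissociated :: "nat \<Rightarrow> int set \<Rightarrow> bool" where
  "dissociated N L \<longleftrightarrow> (\<forall>e \<in> L \<rightarrow>\<^sub>E {-1, 0, 1}. int N dvd (\<Sum>l\<in>L. e l * l) \<longrightarrow> (\<forall>l\<in>L. e l = 0))"

text \<open>Each factor is a trigonometric polynomial with frequencies \<open>-l\<close>, \<open>0\<close>, \<open>l\<close>. After expanding the
  product, dissociativity leaves only the constant frequency.\<close>
lemma riesz_product:
  fixes w :: "int \<Rightarrow> complex" and C S :: real
  assumes N: "N > 0" and L: "finite L" "dissociated N L"
  shows "(\<Sum>x\<in>{0..<int N}. \<Prod>l\<in>L. C + S * Re (w l * ec N (l * x))) = real N * C ^ card L"
proof -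
  define cf where "cf l e = (if e = 0 then of_real C
      else if e = 1 then of_real (S / 2) * w l else of_real (S / 2) * cnj (w l))" for l and e :: int
  let ?E = "L \<rightarrow>\<^sub>E {-1, 0, 1 :: int}"
  have finE: "finite ?E" using L by (intro finite_PiE) auto
  have fac: "complex_of_real (C + S * Re (w l * ec N (l * x)))
      = (\<Sum>e\<in>{-1, 0, 1}. cf l e * ec N (e * (l * x)))" for l x
  proof -
    have "complex_of_real (C + S * Re z) = of_real C + of_real (S / 2) * (z + cnj z)" for z
      by (simp add: complex_add_cnj)
    then have "complex_of_real (C + S * Re (w l * ec N (l * x)))
        = of_real C + of_real (S / 2) * (w l * ec N (l * x) + cnj (w l) * cnj (ec N (l * x)))"
      by (simp only: complex_cnj_mult)
    then show ?thesis by (simp add: cf_def ec_minus algebra_simps)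
  qed
  have "complex_of_real (\<Sum>x\<in>{0..<int N}. \<Prod>l\<in>L. C + S * Re (w l * ec N (l * x)))
      = (\<Sum>x\<in>{0..<int N}. \<Prod>l\<in>L. \<Sum>e\<in>{-1, 0, 1}. cf l e * ec N (e * (l * x)))"
    by (simp only: of_real_sum of_real_prod fac)
  also have "\<dots> = (\<Sum>x\<in>{0..<int N}. \<Sum>e\<in>?E. \<Prod>l\<in>L. cf l (e l) * ec N (e l * (l * x)))"
    using L by (intro sum.cong refl prod_sum_PiE) auto
  also have "\<dots> = (\<Sum>e\<in>?E. \<Sum>x\<in>{0..<int N}. (\<Prod>l\<in>L. cf l (e l)) * ec N (x * (\<Sum>l\<in>L. e l * l)))"
    by (subst sum.swap, intro sum.cong refl)
      (simp add: prod.distrib sum_distrib_left mult_ac flip: ec_sum)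
  also have "\<dots> = (\<Sum>e\<in>?E. (\<Prod>l\<in>L. cf l (e l)) * (if int N dvd (\<Sum>l\<in>L. e l * l) then of_nat N else 0))"
    by (simp only: sum_distrib_left[symmetric] sum_ec[OF N])
  also have "\<dots> = (\<Sum>e\<in>?E. if e = (\<lambda>l\<in>L. 0) then of_real (real N * C ^ card L) else 0)"
  proof (intro sum.cong refl)
    fix e assume e: "e \<in> ?E"
    show "(\<Prod>l\<in>L. cf l (e l)) * (if int N dvd (\<Sum>l\<in>L. e l * l) then of_nat N else 0)
        = (if e = (\<lambda>l\<in>L. 0) then of_real (real N * C ^ card L) else 0)"
    proof (cases "e = (\<lambda>l\<in>L. 0)")
      case True
      then have "(\<Prod>l\<in>L. cf l (e l)) = of_real C ^ card L" "(\<Sum>l\<in>L. e l * l) = 0"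
        by (simp_all add: cf_def)
      then show ?thesis using True by simp
    next
      case False
      have "\<not> int N dvd (\<Sum>l\<in>L. e l * l)"
      proof
        assume "int N dvd (\<Sum>l\<in>L. e l * l)"
        then have "\<forall>l\<in>L. e l = 0" using L(2) e by (simp add: dissociated_def)
        then have "e = (\<lambda>l\<in>L. 0)" using e by (intro PiE_ext[of e L "\<lambda>_. {-1, 0, 1}"]) auto
        then show False using False by simp
      qed
      then show ?thesis using False by simp
    qed
  qed
  also have "\<dots> = of_real (real N * C ^ card L)"
    using finE by (subst sum.delta) (auto simp: PiE_iff)
  finally show ?thesis by (simp only: of_real_eq_iff)
qed

lemma exp_half_le_chord:
  fixes u :: real
  assumes "\<bar>u\<bar> \<le> 1"
  shows "exp (u / 2) \<le> (exp (1/2) + exp (-1/2)) / 2 + (exp (1/2) - exp (-1/2)) / 2 * u"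
proof -
  have tangent: "exp z * (1 + y - z) \<le> exp y" for y z :: real
  proof -
    have "exp z * (1 + (y - z)) \<le> exp z * exp (y - z)"
      by (intro mult_left_mono exp_ge_add_one_self) auto
    also have "\<dots> = exp y" by (simp flip: exp_add)
    finally show ?thesis by (simp add: add_diff_eq)
  qed
  have "exp (u / 2) = (1 + u) / 2 * (exp (u / 2) * (1 + 1/2 - u/2)) + (1 - u) / 2 * (exp (u / 2) * (1 + (-1/2) - u/2))"
    by (simp add: field_simps)
  also have "\<dots> \<le> (1 + u) / 2 * exp (1/2) + (1 - u) / 2 * exp (-1/2)"
    using assms by (intro add_mono mult_left_mono tangent) auto
  finally show ?thesis by (simp add: field_simps)
qed

lemma cosh_half_le: "(exp (1/2) + exp (-1/2)) / 2 \<le> exp (3/16 :: real)"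
proof -
  have "exp (1/2 :: real) ^ 2 \<le> (7/4)\<^sup>2"
    using exp_le by (simp add: power2_eq_square flip: exp_add)
  then have up: "exp (1/2 :: real) \<le> 7/4" by (rule power2_le_imp_le) simp
  have "exp (1/2 :: real) \<ge> 1 + 1/2 + (1/2)\<^sup>2 / 2" by (rule exp_lower_Taylor_quadratic) simp
  then have "inverse (exp (1/2 :: real)) \<le> inverse (13/8)"
    by (intro le_imp_inverse_le) (auto simp: power2_eq_square)
  then have low: "exp (-1/2 :: real) \<le> 8/13" by (simp add: exp_minus)
  have "exp (3/16 :: real) \<ge> 1 + 3/16 + (3/16)\<^sup>2 / 2" by (rule exp_lower_Taylor_quadratic) simp
  with up low show ?thesis by (simp add: power2_eq_square)
qed

text \<open>Let \<open>G x\<close> be half the sum over \<open>l \<in> L\<close> of the cosines whose phases are aligned with the Fourier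
  coefficients of \<open>T\<close>. Its mean over \<open>T\<close> is at least \<open>|L| / 4\<close>, so by convexity the mean of \<open>exp (G x)\<close>
  over \<open>T\<close> is at least \<open>exp (|L| / 4)\<close>. Over the whole group \<open>exp (G x)\<close> is dominated by a Riesz product
  of mean at most \<open>exp (3 |L| / 16)\<close>. As \<open>T\<close> has density \<open>|T| / N\<close>, comparing the two bounds \<open>|L|\<close>.\<close>
lemma card_dissociated_spectrum:
  fixes T L :: "int set"
  assumes N: "N > 0" and T: "finite T" "T \<noteq> {}" "inj_on (\<lambda>x. x mod int N) T"
    and L: "finite L" "dissociated N L"
    and spec: "\<And>l. l \<in> L \<Longrightarrow> real (card T) / 2 \<le> norm (ft N T l)"
  shows "real (card L) \<le> 16 * ln (real N / real (card T))"
proof -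
  have cT: "real (card T) > 0" using T by (simp add: card_gt_0_iff)
  define C where "C = (exp (1/2) + exp (-1/2)) / (2 :: real)"
  define S where "S = (exp (1/2) - exp (-1/2)) / (2 :: real)"
  define w where "w l = cnj (ft N T l) / of_real (norm (ft N T l))" for l
  define u where "u l x = Re (w l * ec N (l * x))" for l x
  define G where "G x = (\<Sum>l\<in>L. u l x) / 2" for x
  define R where "R x = (\<Prod>l\<in>L. C + S * u l x)" for x
  have nw: "norm (w l) = 1" if "l \<in> L" for l
  proof -
    have "norm (ft N T l) \<noteq> 0" using spec[OF that] cT by linarith
    then show ?thesis by (simp add: w_def norm_divide)
  qed
  have u1: "\<bar>u l x\<bar> \<le> 1" if "l \<in> L" for l x
    unfolding u_def using abs_Re_le_cmod[of "w l * ec N (l * x)"] nw[OF that] by (simp add: norm_mult)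
  have uT: "(\<Sum>x\<in>T. u l x) = norm (ft N T l)" if "l \<in> L" for l
  proof -
    have n0: "norm (ft N T l) \<noteq> 0" using spec[OF that] cT by auto
    have "(\<Sum>x\<in>T. u l x) = Re (w l * ft N T l)"
      by (simp add: u_def ft_def sum_distrib_left)
    also have "w l * ft N T l = of_real ((norm (ft N T l))\<^sup>2) / of_real (norm (ft N T l))"
      unfolding complex_norm_square by (simp add: w_def mult.commute)
    also have "\<dots> = of_real (norm (ft N T l))" using n0 by (simp add: power2_eq_square)
    finally show ?thesis by simp
  qed
  let ?g = "real (card L) / 4"
  have "real (card T) * ?g = (\<Sum>l\<in>L. real (card T) / 2) / 2" by simp
  also have "\<dots> \<le> (\<Sum>l\<in>L. \<Sum>x\<in>T. u l x) / 2"
    using spec by (intro divide_right_mono sum_mono) (auto simp: uT)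
  also have "\<dots> = (\<Sum>x\<in>T. G x)"
    by (simp add: G_def sum_divide_distrib) (rule sum.swap)
  finally have avg: "real (card T) * ?g \<le> (\<Sum>x\<in>T. G x)" .
  have expR: "exp (G x) \<le> R x" and R0: "R x \<ge> 0" for x
  proof -
    have "exp (G x) = (\<Prod>l\<in>L. exp (u l x / 2))"
      using L by (simp add: G_def sum_divide_distrib exp_sum)
    also have "\<dots> \<le> R x"
      unfolding R_def C_def S_def by (intro prod_mono conjI exp_half_le_chord u1) simp
    finally show "exp (G x) \<le> R x" .
    then show "R x \<ge> 0" by (smt (verit) exp_gt_zero)
  qed
  have Rmod: "R (x mod int N) = R x" for x
  proof -
    have "ec N (l * (x mod int N)) = ec N (l * x)" for l
    proof (rule ec_cong[OF N])
      have "l * (x mod int N) - l * x = int N * - (l * (x div int N))"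
        by (simp add: minus_mult_div_eq_mod[symmetric] algebra_simps)
      then show "int N dvd l * (x mod int N) - l * x" by (metis dvd_triv_left)
    qed
    then show ?thesis by (simp add: R_def u_def)
  qed
  \<comment> \<open>Jensen's inequality, in the form of the tangent to \<open>exp\<close> at \<open>?g\<close>.\<close>
  have "real (card T) * exp ?g = exp ?g * (real (card T) + (real (card T) * ?g - real (card T) * ?g))"
    by simp
  also have "\<dots> \<le> exp ?g * (real (card T) + ((\<Sum>x\<in>T. G x) - real (card T) * ?g))"
    using avg by (intro mult_left_mono add_left_mono diff_right_mono) auto
  also have "\<dots> = (\<Sum>x\<in>T. exp ?g * (1 + (G x - ?g)))"
    by (simp add: sum.distrib sum_subtractf flip: sum_distrib_left)
  also have "\<dots> \<le> (\<Sum>x\<in>T. exp ?g * exp (G x - ?g))"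
    by (intro sum_mono mult_left_mono exp_ge_add_one_self) auto
  also have "\<dots> = (\<Sum>x\<in>T. exp (G x))" by (simp flip: exp_add)
  also have "\<dots> \<le> (\<Sum>x\<in>T. R (x mod int N))" unfolding Rmod by (intro sum_mono expR)
  also have "\<dots> = (\<Sum>x\<in>(\<lambda>x. x mod int N) ` T. R x)" using T(3) by (simp add: sum.reindex)
  also have "\<dots> \<le> (\<Sum>x\<in>{0..<int N}. R x)" using N R0 by (intro sum_mono2) auto
  also have "\<dots> = real N * C ^ card L"
    unfolding R_def u_def by (rule riesz_product[OF N L])
  also have "\<dots> \<le> real N * exp (3/16) ^ card L"
    unfolding C_def using cosh_half_le by (intro mult_left_mono power_mono) (auto intro!: add_nonneg_nonneg)
  also have "exp (3/16 :: real) ^ card L = exp (3 * real (card L) / 16)" by (simp flip: exp_of_nat_mult)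
  finally have "real (card T) * exp ?g \<le> real N * exp (3 * real (card L) / 16)" .
  then have "exp ?g / exp (3 * real (card L) / 16) \<le> real N / real (card T)"
    using cT by (simp add: field_simps)
  then have "exp (real (card L) / 16) \<le> real N / real (card T)" by (simp flip: exp_diff)
  then have "real (card L) / 16 \<le> ln (real N / real (card T))"
    using N cT by (subst ln_ge_iff) auto
  then show ?thesis by simp
qed

text \<open>A maximal dissociated subset \<open>L\<close> of the spectrum: by maximality, every other frequency of the
  spectrum is a combination of elements of \<open>L\<close> with coefficients \<open>-1\<close>, \<open>0\<close>, \<open>1\<close>. Only the
  consequence for the characters is recorded.\<close>
lemma chang:
  fixes T :: "int set"
  assumes N: "N > 0" and T: "finite T" "T \<noteq> {}" "inj_on (\<lambda>x. x mod int N) T"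
  obtains L where "finite L" "real (card L) \<le> 16 * ln (real N / real (card T))"
    "\<And>r t. r \<in> {0..<int N} \<Longrightarrow> real (card T) / 2 \<le> norm (ft N T r) \<Longrightarrow>
      norm (ec N (r * t) - 1) \<le> (\<Sum>l\<in>L. norm (ec N (l * t) - 1))"
proof -
  define Spec where "Spec = {r \<in> {0..<int N}. real (card T) / 2 \<le> norm (ft N T r)}"
  define Dis where "Dis = {L. L \<subseteq> Spec \<and> dissociated N L}"
  have finS: "finite Spec" by (rule finite_subset[of _ "{0..<int N}"]) (auto simp: Spec_def)
  have "finite Dis" using finS by (intro finite_subset[of Dis "Pow Spec"]) (auto simp: Dis_def)
  moreover have "{} \<in> Dis" by (auto simp: Dis_def dissociated_def)
  ultimately obtain L where L: "L \<in> Dis" "\<And>M. M \<in> Dis \<Longrightarrow> L \<subseteq> M \<Longrightarrow> L = M"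
    using finite_has_maximal[of Dis] by blast
  have finL: "finite L" using L finS finite_subset by (auto simp: Dis_def)
  have dis: "dissociated N L" and LS: "L \<subseteq> Spec" using L by (auto simp: Dis_def)
  show ?thesis
  proof (rule that[OF finL])
    show "real (card L) \<le> 16 * ln (real N / real (card T))"
      using LS by (intro card_dissociated_spectrum[OF N T finL dis]) (auto simp: Spec_def)
  next
    fix r t assume r: "r \<in> {0..<int N}" "real (card T) / 2 \<le> norm (ft N T r)"
    let ?q = "\<lambda>l. norm (ec N (l * t) - 1)"
    show "?q r \<le> (\<Sum>l\<in>L. ?q l)"
    proof (cases "r \<in> L")
      case True
      then show ?thesis using finL by (intro member_le_sum) auto
    next
      case False
      have "insert r L \<notin> Dis" using L(2)[of "insert r L"] False by blast
      then have "\<not> dissociated N (insert r L)" using LS r by (auto simp: Dis_def Spec_def)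
      then obtain e where e: "e \<in> insert r L \<rightarrow>\<^sub>E {-1, 0, 1}" "int N dvd (\<Sum>l\<in>insert r L. e l * l)"
        "\<not> (\<forall>l\<in>insert r L. e l = 0)" unfolding dissociated_def by blast
      have s: "int N dvd e r * r + (\<Sum>l\<in>L. e l * l)" using e(2) finL False by simp
      have er0: "e r \<noteq> 0"
      proof
        assume "e r = 0"
        then have dv: "int N dvd (\<Sum>l\<in>L. restrict e L l * l)" using s by simp
        have "restrict e L \<in> L \<rightarrow>\<^sub>E {-1, 0, 1}" using e(1) by auto
        then have "\<forall>l\<in>L. restrict e L l = 0" using dis dv unfolding dissociated_def by blast
        then show False using e(3) \<open>e r = 0\<close> by auto
      qed
      have small: "?q (e l * l) \<le> ?q l" if "l \<in> L" for l
      proof -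
        have "e l \<in> {-1, 0, 1}" using e(1) that by auto
        then show ?thesis using norm_ec_minus_1_minus[of N "l * t"] by auto
      qed
      have "ec N (e r * r * t) = ec N (- (\<Sum>l\<in>L. e l * l) * t)"
      proof (rule ec_cong[OF N])
        have "e r * r * t - - (\<Sum>l\<in>L. e l * l) * t = (e r * r + (\<Sum>l\<in>L. e l * l)) * t"
          by (simp add: algebra_simps)
        then show "int N dvd e r * r * t - - (\<Sum>l\<in>L. e l * l) * t" using s by simp
      qed
      then have "?q (e r * r) = norm (ec N (- (\<Sum>l\<in>L. e l * l * t)) - 1)"
        by (simp add: sum_distrib_right)
      also have "\<dots> = norm (ec N (\<Sum>l\<in>L. e l * l * t) - 1)" by (rule norm_ec_minus_1_minus)
      also have "\<dots> \<le> (\<Sum>l\<in>L. ?q (e l * l))" by (rule norm_ec_minus_1_sum)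
      also have "\<dots> \<le> (\<Sum>l\<in>L. ?q l)" by (intro sum_mono small)
      finally have main: "?q (e r * r) \<le> (\<Sum>l\<in>L. ?q l)" .
      have "e r = 1 \<or> e r = -1" using e(1) er0 by auto
      then have "?q (e r * r) = ?q r" using norm_ec_minus_1_minus[of N "r * t"] by auto
      with main show ?thesis by simp
    qed
  qed
qed

lemma abs_diff_le_if_div_eq:
  fixes X Y n :: int
  assumes "n > 0" "X div n = Y div n"
  shows "\<bar>Y - X\<bar> \<le> n"
proof -
  have "Y - X = Y mod n - X mod n"
    using div_mult_mod_eq[of X n, unfolded assms(2)] div_mult_mod_eq[of Y n] by linarith
  moreover have "0 \<le> X mod n" "X mod n < n" "0 \<le> Y mod n" "Y mod n < n" using assms(1) by auto
  ultimately show ?thesis by linarith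
qed

text \<open>Dirichlet's theorem: two of the \<open>N\<close> points \<open>(l * x / N mod 1)\<^sub>l\<close> lie in the same of
  \<open>M ^ card L\<close> boxes of side \<open>1 / M\<close>, and their difference is the required \<open>t\<close>.\<close>
lemma simultaneous_approximation:
  assumes L: "finite L" and M: "M > 0" and N: "M ^ card L < N"
  obtains t where "0 < t" "t < int N" "\<And>l. l \<in> L \<Longrightarrow> norm (ec N (l * t) - 1) \<le> 2 * pi / real M"
proof -
  have N0: "int N > 0" using N by simp
  define box where "box x = (\<lambda>l\<in>L. int M * (l * x mod int N) div int N)" for x
  have range: "int M * (y mod int N) div int N \<in> {0..<int M}" for y
  proof -
    have "int M * (y mod int N) < int M * int N" using M N0 by simp
    moreover have "int M * (y mod int N) div int N * int N \<le> int M * (y mod int N)"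
      using N0 div_mult_mod_eq[of "int M * (y mod int N)" "int N"]
        pos_mod_sign[of "int N" "int M * (y mod int N)"] by linarith
    ultimately have "int M * (y mod int N) div int N * int N < int M * int N" by linarith
    then have "int M * (y mod int N) div int N < int M" using N0 by simp
    moreover have "0 \<le> int M * (y mod int N) div int N"
      using N0 by (intro pos_imp_zdiv_nonneg_iff[THEN iffD2]) auto
    ultimately show ?thesis by simp
  qed
  have sub: "box ` {0..<int N} \<subseteq> L \<rightarrow>\<^sub>E {0..<int M}"
    using range by (auto simp: box_def)
  have "card (L \<rightarrow>\<^sub>E {0..<int M}) = M ^ card L" using L by (simp add: card_PiE)
  moreover have "finite (L \<rightarrow>\<^sub>E {0..<int M})" using L by (intro finite_PiE) auto
  ultimately have "card (box ` {0..<int N}) < card {0..<int N}"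
    using card_mono[OF _ sub] N by simp
  then have "\<not> inj_on box {0..<int N}" by (rule pigeonhole)
  then obtain x y where "x \<in> {0..<int N}" "y \<in> {0..<int N}" "box x = box y" "x \<noteq> y"
    unfolding inj_on_def by blast
  then obtain x y where xy: "0 \<le> x" "x < y" "y < int N" "box x = box y"
    by (metis (no_types) atLeastLessThan_iff linorder_neqE)
  show ?thesis
  proof (rule that[of "y - x"])
    show "0 < y - x" "y - x < int N" using xy by auto
    fix l assume l: "l \<in> L"
    let ?p = "l * x mod int N" and ?q = "l * y mod int N"
    have "int M * ?p div int N = int M * ?q div int N"
      using fun_cong[OF xy(4), of l] l by (simp add: box_def)
    from abs_diff_le_if_div_eq[OF N0 this] have "\<bar>int M * ?q - int M * ?p\<bar> \<le> int N" .
    then have "\<bar>int M * (?q - ?p)\<bar> \<le> int N" by (simp add: right_diff_distrib)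
    then have "int M * \<bar>?q - ?p\<bar> \<le> int N" by (simp add: abs_mult)
    then have "real_of_int (int M * \<bar>?q - ?p\<bar>) \<le> real_of_int (int N)" by (simp only: of_int_le_iff)
    then have d: "real M * \<bar>real_of_int (?q - ?p)\<bar> \<le> real N" by simp
    have "ec N (l * (y - x)) = ec N (?q - ?p)"
    proof (rule ec_cong)
      have "(l * (y - x)) mod int N = (?q - ?p) mod int N" by (simp add: mod_diff_eq right_diff_distrib)
      then show "int N dvd l * (y - x) - (?q - ?p)" by (simp only: mod_eq_dvd_iff)
    qed (use N0 in simp)
    then have "norm (ec N (l * (y - x)) - 1) = norm (cis (2 * pi * real_of_int (?q - ?p) / real N) - 1)"
      by (simp only: ec_def)
    also have "\<dots> \<le> \<bar>2 * pi * real_of_int (?q - ?p) / real N\<bar>" by (rule norm_cis_minus_1_le)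
    also have "\<dots> = 2 * pi * (\<bar>real_of_int (?q - ?p)\<bar> / real N)" by (simp add: abs_mult)
    also have "\<dots> \<le> 2 * pi * (1 / real M)"
      using d M N0 by (intro mult_left_mono) (auto simp: field_simps)
    finally show "norm (ec N (l * (y - x)) - 1) \<le> 2 * pi / real M" by simp
  qed
qed

section \<open>Progressions modulo \<open>N\<close>\<close>
lemma card_periodic_shift:
  fixes P :: "int \<Rightarrow> bool"
  assumes N: "N > 0" and per: "\<And>x y. int N dvd x - y \<Longrightarrow> P x = P y"
  shows "card {x \<in> {0..<int N}. P (x + u)} = card {x \<in> {0..<int N}. P x}"
proof (rule bij_betw_same_card[of "\<lambda>x. (x + u) mod int N"],
    rule bij_betw_byWitness[of _ "\<lambda>x. (x - u) mod int N"])
  have m: "P (y mod int N) = P y" for y by (rule per) (simp add: mod_eq_dvd_iff[symmetric])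
  show "\<forall>x\<in>{x \<in> {0..<int N}. P (x + u)}. ((x + u) mod int N - u) mod int N = x"
    by (auto simp: mod_diff_left_eq)
  show "\<forall>x\<in>{x \<in> {0..<int N}. P x}. ((x - u) mod int N + u) mod int N = x"
    by (auto simp: mod_add_left_eq)
  show "(\<lambda>x. (x + u) mod int N) ` {x \<in> {0..<int N}. P (x + u)} \<subseteq> {x \<in> {0..<int N}. P x}"
    using N m by auto
  show "(\<lambda>x. (x - u) mod int N) ` {x \<in> {0..<int N}. P x} \<subseteq> {x \<in> {0..<int N}. P (x + u)}"
  proof
    fix z assume "z \<in> (\<lambda>x. (x - u) mod int N) ` {x \<in> {0..<int N}. P x}"
    then obtain x where x: "P x" "z = (x - u) mod int N" by auto
    have "P (z + u) = P x"
      unfolding x(2) by (rule per) (simp add: mod_eq_dvd_iff[symmetric] mod_add_left_eq)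
    then show "z \<in> {x \<in> {0..<int N}. P (x + u)}" using x N by simp
  qed
qed

text \<open>Differences are measured between square roots because that is the scale on which
  sampling is accurate.\<close>
definition shift_discrepancy :: "nat \<Rightarrow> (int \<Rightarrow> real) \<Rightarrow> real \<Rightarrow> int \<Rightarrow> nat" where
  "shift_discrepancy N f c t = card {x \<in> {0..<int N}. \<bar>sqrt (f (x + t)) - sqrt (f x)\<bar> > c}"

text \<open>Translation by \<open>t'\<close> preserves the number of exceptional points for \<open>t\<close>, so a triangle
  inequality holds for both the tolerance and the count.\<close>
lemma shift_discrepancy_add:
  assumes N: "N > 0" and per: "\<And>x y. int N dvd x - y \<Longrightarrow> f x = f y"
  shows "shift_discrepancy N f (c + c') (t + t')
    \<le> shift_discrepancy N f c t + shift_discrepancy N f c' t'"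
proof -
  let ?P = "\<lambda>x. \<bar>sqrt (f (x + t)) - sqrt (f x)\<bar> > c"
  have perP: "?P x = ?P y" if "int N dvd x - y" for x y
    using per[OF that] per[of "x + t" "y + t"] that by simp
  have "{x \<in> {0..<int N}. \<bar>sqrt (f (x + (t + t'))) - sqrt (f x)\<bar> > c + c'}
      \<subseteq> {x \<in> {0..<int N}. ?P (x + t')} \<union> {x \<in> {0..<int N}. \<bar>sqrt (f (x + t')) - sqrt (f x)\<bar> > c'}"
    by (auto simp: algebra_simps)
  then have "shift_discrepancy N f (c + c') (t + t')
      \<le> card ({x \<in> {0..<int N}. ?P (x + t')} \<union> {x \<in> {0..<int N}. \<bar>sqrt (f (x + t')) - sqrt (f x)\<bar> > c'})"
    unfolding shift_discrepancy_def
    by (intro card_mono finite_UnI finite_subset[of "{x \<in> {0..<int N}. Q x}" "{0..<int N}" for Q]) auto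
  also have "\<dots> \<le> card {x \<in> {0..<int N}. ?P (x + t')} + shift_discrepancy N f c' t'"
    unfolding shift_discrepancy_def by (rule card_Un_le)
  also have "card {x \<in> {0..<int N}. ?P (x + t')} = shift_discrepancy N f c t"
    unfolding shift_discrepancy_def by (rule card_periodic_shift[OF N perP])
  finally show ?thesis .
qed

lemma shift_discrepancy_sum:
  assumes N: "N > 0" and per: "\<And>x y. int N dvd x - y \<Longrightarrow> f x = f y"
    and D: "\<And>j. j < m \<Longrightarrow> real (shift_discrepancy N f c (t j)) \<le> D"
  shows "real (shift_discrepancy N f (real m * c) (\<Sum>j<m. t j)) \<le> real m * D"
  using D
proof (induction m)
  case 0
  then show ?case by (simp add: shift_discrepancy_def)
next
  case (Suc m)
  have "shift_discrepancy N f (c + real m * c) (t m + (\<Sum>j<m. t j))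
      \<le> shift_discrepancy N f c (t m) + shift_discrepancy N f (real m * c) (\<Sum>j<m. t j)"
    by (rule shift_discrepancy_add[OF N per])
  then have "real (shift_discrepancy N f (c + real m * c) (t m + (\<Sum>j<m. t j)))
      \<le> real (shift_discrepancy N f c (t m)) + real (shift_discrepancy N f (real m * c) (\<Sum>j<m. t j))"
    by linarith
  also have "\<dots> \<le> D + real m * D" using Suc by (intro add_mono) auto
  finally show ?case by (simp add: algebra_simps)
qed

lemma sum_conv:
  assumes "N > 0" "finite A" "A \<noteq> {}" "finite B" "inj_on (\<lambda>x. x mod int N) B"
  shows "(\<Sum>x\<in>{0..<int N}. conv N A B x) = real (card B)"
proof -
  have cA: "card A > 0" using assms by (simp add: card_gt_0_iff)
  have "card {x \<in> {0..<int N}. in_residues N B (x - a)} = card B" for a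
  proof -
    have "card {x \<in> {0..<int N}. in_residues N B (x + (- a))} = card {x \<in> {0..<int N}. in_residues N B x}"
      by (rule card_periodic_shift) (use assms in_residues_cong in auto)
    also have "{x \<in> {0..<int N}. in_residues N B x} = (\<lambda>x. x mod int N) ` B"
    proof (intro equalityI subsetI)
      fix x assume "x \<in> {x \<in> {0..<int N}. in_residues N B x}"
      then obtain b where b: "0 \<le> x" "x < int N" "b \<in> B" "int N dvd x - b"
        by (auto simp: in_residues_def)
      then have "x = b mod int N" by (simp add: mod_eq_dvd_iff[symmetric])
      then show "x \<in> (\<lambda>x. x mod int N) ` B" using b by blast
    next
      fix x assume "x \<in> (\<lambda>x. x mod int N) ` B"
      then show "x \<in> {x \<in> {0..<int N}. in_residues N B x}"
        using assms(1) by (auto simp: in_residues_def mod_eq_dvd_iff[symmetric])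
    qed
    finally show ?thesis using assms(5) by (simp add: card_image)
  qed
  then have "real (card A) * real (card B)
      = (\<Sum>a\<in>A. real (card {x \<in> {0..<int N}. in_residues N B (x - a)}))" by simp
  also have "\<dots> = (\<Sum>x\<in>{0..<int N}. real (card {a \<in> A. in_residues N B (x - a)}))"
    using sum_multicount_gen[of A "{0..<int N}" "\<lambda>a x. in_residues N B (x - a)"
        "\<lambda>x. card {a \<in> A. in_residues N B (x - a)}"] assms
    by (simp only: of_nat_sum[symmetric] of_nat_eq_iff) simp
  also have "\<dots> = real (card A) * (\<Sum>x\<in>{0..<int N}. conv N A B x)"
    using cA by (simp add: sum_distrib_left conv_def)
  finally show ?thesis using cA by simp
qed

text \<open>The convolution is at most \<open>1\<close>, and values below \<open>beta / 2\<close> contribute at most half of its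
  total mass \<open>card B\<close>.\<close>
lemma card_conv_large:
  fixes beta :: real
  assumes "N > 0" "finite A" "A \<noteq> {}" "finite B" "inj_on (\<lambda>x. x mod int N) B"
    and beta: "beta > 0" "beta * real (card (A + B)) \<le> real (card B)"
  shows "beta / 2 * real (card (A + B)) \<le> real (card {x \<in> {0..<int N}. conv N A B x \<ge> beta / 2})"
proof -
  let ?P = "{x \<in> {0..<int N}. conv N A B x \<ge> beta / 2}"
  let ?S = "{x \<in> {0..<int N}. conv N A B x \<noteq> 0}"
  have fin: "finite ?P" "finite ?S" by (rule finite_subset[of _ "{0..<int N}"]; auto)+
  have "real (card B) = (\<Sum>x\<in>{0..<int N}. conv N A B x)" using sum_conv assms by metis
  also have "\<dots> \<le> (\<Sum>x\<in>{0..<int N}. (if x \<in> ?P then 1 else 0) + (if x \<in> ?S then beta / 2 else 0))"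
  proof (rule sum_mono)
    fix x assume "x \<in> {0..<int N}"
    then show "conv N A B x \<le> (if x \<in> ?P then 1 else 0) + (if x \<in> ?S then beta / 2 else 0)"
      using beta conv_le_1[OF assms(2), of N B x] by auto
  qed
  also have "\<dots> = real (card ?P) + beta / 2 * real (card ?S)"
    by (simp add: sum.distrib sum.If_cases Int_def conj_commute)
  also have "\<dots> \<le> real (card ?P) + beta / 2 * real (card (A + B))"
    using card_conv_support[OF assms(2,4,1)] beta by (intro add_left_mono mult_left_mono) auto
  finally show ?thesis using beta(2) by linarith
qed

text \<open>The heart of the argument, with explicit conditions on the parameters: \<open>m\<close> is the length of the
  walks, \<open>k\<close> the number of samples, \<open>d\<close> a bound for the number of frequencies from Chang's theorem
  and \<open>1 / M\<close> the precision of the simultaneous approximation. Condition \<open>h1\<close> disposes of the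
  frequencies outside the large spectrum, \<open>h2\<close> makes the exceptional points rarer than the points
  where the convolution is large, even after a union over \<open>L\<close> translates, \<open>h4\<close> controls the large
  spectrum along \<open>L\<close> steps, and \<open>h5\<close> is the pigeonhole condition.\<close>
lemma progression_mod_N:
  fixes A B :: "int set" and KA KB d :: real and N m k M L :: nat
  defines "n \<equiv> real (card (A + B))"
  assumes N: "N > 0" and fin: "finite A" "finite B" and ne: "A \<noteq> {}" "B \<noteq> {}"
    and inj: "inj_on (\<lambda>x. x mod int N) A" "inj_on (\<lambda>x. x mod int N) B"
    and KA: "n \<le> KA * real (card A)" and KB: "n \<le> KB * real (card B)"
    and pos: "m > 0" "k > 0" "L > 0" "M > 0"
    and h1: "32 * sqrt KA * KB \<le> 4 ^ m"
    and h2: "1024 * real L * real m * KB\<^sup>2 < exp (real k / (256 * (real m)\<^sup>2 * KB))"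
    and h3: "16 * ln (2 * real N * KA ^ k / real (card B)) \<le> d"
    and h4: "32 * pi * d * real L * sqrt KA * KB \<le> real M"
    and h5: "real M powr d < real N"
  obtains t y where "\<not> int N dvd t"
    "\<And>j. j < L \<Longrightarrow> \<exists>a\<in>A. \<exists>b\<in>B. int N dvd (y + int j * t) - (a + b)"
proof -
  have c: "real (card A) > 0" "real (card B) > 0" using fin ne by (auto simp: card_gt_0_iff)
  have AB: "real (card A) \<le> n" "real (card B) \<le> n"
    using card_le_card_plus fin ne by (auto simp: n_def)
  have n0: "n > 0" using c AB by linarith
  have "1 * real (card A) \<le> KA * real (card A)" "1 * real (card B) \<le> KB * real (card B)"
    using KA KB AB by linarith+
  then have KA1: "KA \<ge> 1" and KB1: "KB \<ge> 1" using c by (simp_all only: mult_le_cancel_right_pos)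
  define f where "f = conv N A B"
  have per: "f x = f y" if "int N dvd x - y" for x y using conv_cong[OF that] by (simp add: f_def)
  have f0: "f x \<ge> 0" and f1: "f x \<le> 1" for x using conv_nonneg conv_le_1 fin by (auto simp: f_def)
  define beta where "beta = 1 / KB"
  have beta: "beta > 0" "beta \<le> 1" using KB1 by (auto simp: beta_def)
  \<comment> \<open>A walk of \<open>m\<close> steps, each costing \<open>2 * eta\<close> apart from exceptional points, then changes the
    square root by at most \<open>sqrt beta / 8\<close>, well below a starting value of \<open>sqrt (beta / 2)\<close>.\<close>
  define eta where "eta = sqrt beta / (16 * real m)"
  have eta: "eta > 0" using beta pos by (simp add: eta_def)
  have eta2: "real m * (2 * eta) = sqrt beta / 8" using pos by (simp add: eta_def)
  define e where "e = exp (- real k * eta\<^sup>2)"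
  have e0: "e > 0" by (simp add: e_def)
  have e: "1024 * real L * real m * KB\<^sup>2 * e < 1"
  proof -
    have "- real k * eta\<^sup>2 = - (real k / (256 * (real m)\<^sup>2 * KB))"
      using KB1 pos by (simp add: eta_def beta_def power_divide power_mult_distrib)
    then have "e * exp (real k / (256 * (real m)\<^sup>2 * KB)) = 1" by (simp add: e_def flip: exp_add)
    then show ?thesis using mult_strict_left_mono[OF h2 e0] by (simp add: mult_ac)
  qed
  obtain T F where T: "T \<subseteq> B" "real (card B) \<le> 2 * KA ^ k * real (card T)"
    and perF: "\<And>x y. int N dvd x - y \<Longrightarrow> F x = F y"
    and TF: "\<And>b. b \<in> T \<Longrightarrow> real (card {x \<in> {0..<int N}. \<bar>sqrt (F (x + b)) - sqrt (f x)\<bar> > eta}) \<le> 4 * e * n"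
    using almost_periods[OF fin ne KA[unfolded n_def] pos(2) eta N] unfolding f_def e_def n_def by blast
  have finT: "finite T" using T(1) fin finite_subset by blast
  have neT: "T \<noteq> {}" using T(2) c by auto
  have cT: "real (card T) > 0" using finT neT by (simp add: card_gt_0_iff)
  have injT: "inj_on (\<lambda>x. x mod int N) T" using inj(2) T(1) by (rule inj_on_subset)
  have step: "real (shift_discrepancy N f (2 * eta) (b - b')) \<le> 8 * e * n" if b: "b \<in> T" "b' \<in> T" for b b'
  proof -
    let ?P = "\<lambda>b x. \<bar>sqrt (F (x + b)) - sqrt (f x)\<bar> > eta"
    have perP: "?P b' x = ?P b' y" if "int N dvd x - y" for x y
      using per[OF that] perF[of "x + b'" "y + b'"] that by simp
    have "{x \<in> {0..<int N}. \<bar>sqrt (f (x + (b - b'))) - sqrt (f x)\<bar> > 2 * eta}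
        \<subseteq> {x \<in> {0..<int N}. ?P b x} \<union> {x \<in> {0..<int N}. ?P b' (x + (b - b'))}"
    proof
      fix x assume x: "x \<in> {x \<in> {0..<int N}. \<bar>sqrt (f (x + (b - b'))) - sqrt (f x)\<bar> > 2 * eta}"
      have "x + (b - b') + b' = x + b" by simp
      then have "?P b x \<or> ?P b' (x + (b - b'))" using x by auto
      then show "x \<in> {x \<in> {0..<int N}. ?P b x} \<union> {x \<in> {0..<int N}. ?P b' (x + (b - b'))}" using x by blast
    qed
    then have "shift_discrepancy N f (2 * eta) (b - b')
        \<le> card ({x \<in> {0..<int N}. ?P b x} \<union> {x \<in> {0..<int N}. ?P b' (x + (b - b'))})"
      unfolding shift_discrepancy_def
      by (intro card_mono finite_UnI finite_subset[of "{x \<in> {0..<int N}. Q x}" "{0..<int N}" for Q]) auto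
    also have "\<dots> \<le> card {x \<in> {0..<int N}. ?P b x} + card {x \<in> {0..<int N}. ?P b' (x + (b - b'))}"
      by (rule card_Un_le)
    also have "card {x \<in> {0..<int N}. ?P b' (x + (b - b'))} = card {x \<in> {0..<int N}. ?P b' x}"
      by (rule card_periodic_shift[OF N perP])
    finally have "real (shift_discrepancy N f (2 * eta) (b - b'))
        \<le> real (card {x \<in> {0..<int N}. ?P b x}) + real (card {x \<in> {0..<int N}. ?P b' x})" by linarith
    also have "\<dots> \<le> 4 * e * n + 4 * e * n" using b by (intro add_mono TF)
    finally show ?thesis by simp
  qed
  define W where "W = walks m T"
  have finW: "finite W" using finT by (simp add: W_def finite_walks)
  have cW: "real (card W) > 0" using cT by (simp add: W_def card_walks)
  let ?bad = "\<lambda>w x. \<bar>sqrt (f (x + endpoint m w)) - sqrt (f x)\<bar> > sqrt beta / 8"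
  have walk: "real (card {x \<in> {0..<int N}. ?bad w x}) \<le> 8 * real m * e * n" if "w \<in> W" for w
  proof -
    have "fst w \<in> {..<m} \<rightarrow>\<^sub>E T" "snd w \<in> {..<m} \<rightarrow>\<^sub>E T"
      using that unfolding W_def walks_def mem_Times_iff by blast+
    then have "fst w j \<in> T \<and> snd w j \<in> T" if "j < m" for j
      using that PiE_mem[of "fst w" "{..<m}" "\<lambda>_. T" j] PiE_mem[of "snd w" "{..<m}" "\<lambda>_. T" j] by simp
    then have "real (shift_discrepancy N f (real m * (2 * eta)) (\<Sum>j<m. fst w j - snd w j))
        \<le> real m * (8 * e * n)"
      by (intro shift_discrepancy_sum[OF N per] step) auto
    then show ?thesis unfolding eta2 by (simp add: shift_discrepancy_def endpoint_def mult_ac)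
  qed
  define u where "u x = card {w \<in> W. ?bad w x}" for x
  have peru: "u x = u y" if xy: "int N dvd x - y" for x y
  proof -
    have "f (x + s) = f (y + s)" for s using xy by (intro per) simp
    then show ?thesis using per[OF xy] by (simp add: u_def)
  qed
  \<comment> \<open>Outside \<open>E\<close>, nearly all walks hardly change the convolution. The threshold is proportional
    to \<open>beta\<close> because a walk that is not controlled can contribute as much as \<open>1\<close>
    to the average \<open>g\<close>.\<close>
  define E where "E = {x \<in> {0..<int N}. real (u x) > beta / 64 * real (card W)}"
  have finE: "finite E" by (rule finite_subset[of _ "{0..<int N}"]) (auto simp: E_def)
  have cardE: "real (card E) \<le> 512 * real m * e * n * KB"
  proof -
    have "beta / 64 * real (card W) * real (card E) = (\<Sum>x\<in>E. beta / 64 * real (card W))" by simp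
    also have "\<dots> \<le> (\<Sum>x\<in>E. real (u x))" by (intro sum_mono) (auto simp: E_def)
    also have "\<dots> \<le> (\<Sum>x\<in>{0..<int N}. real (u x))" by (intro sum_mono2) (auto simp: E_def)
    also have "\<dots> = real (\<Sum>x\<in>{0..<int N}. card {w \<in> W. ?bad w x})" by (simp add: u_def)
    also have "(\<Sum>x\<in>{0..<int N}. card {w \<in> W. ?bad w x}) = (\<Sum>w\<in>W. card {x \<in> {0..<int N}. ?bad w x})"
      by (rule sum_multicount_gen[symmetric]) (use finW in auto)
    also have "real \<dots> = (\<Sum>w\<in>W. real (card {x \<in> {0..<int N}. ?bad w x}))" by (rule of_nat_sum)
    also have "\<dots> \<le> (\<Sum>w\<in>W. 8 * real m * e * n)" by (intro sum_mono walk)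
    finally have "real (card W) * (beta / 64 * real (card E)) \<le> real (card W) * (8 * real m * e * n)"
      by (simp add: mult_ac)
    then have "beta / 64 * real (card E) \<le> 8 * real m * e * n" using cW by simp
    then show ?thesis using KB1 by (simp add: beta_def field_simps)
  qed
  define P where "P = {x \<in> {0..<int N}. f x \<ge> beta / 2}"
  have cardP: "beta / 2 * n \<le> real (card P)"
    unfolding P_def f_def n_def
    by (rule card_conv_large) (use N fin ne inj beta KB KB1 in \<open>auto simp: beta_def n_def field_simps\<close>)
  have LE: "real L * real (card E) < real (card P)"
  proof -
    have "real L * real (card E) \<le> real L * (512 * real m * e * n * KB)"
      using cardE by (intro mult_left_mono) auto
    also have "\<dots> = (1024 * real L * real m * KB\<^sup>2 * e) * (beta / 2 * n)"
      using KB1 by (simp add: beta_def power2_eq_square)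
    also have "\<dots> < 1 * (beta / 2 * n)" using e beta n0 by (intro mult_strict_right_mono) auto
    finally show ?thesis using cardP by simp
  qed
  obtain S where S: "finite S" "real (card S) \<le> 16 * ln (real N / real (card T))"
    and Sspec: "\<And>r t. r \<in> {0..<int N} \<Longrightarrow> real (card T) / 2 \<le> norm (ft N T r) \<Longrightarrow>
      norm (ec N (r * t) - 1) \<le> (\<Sum>l\<in>S. norm (ec N (l * t) - 1))"
    using chang[OF N finT neT injT] by blast
  have Sd: "real (card S) \<le> d"
  proof -
    have K0: "KA ^ k > 0" using KA1 by simp
    have "real N / real (card T) \<le> 2 * real N * KA ^ k / real (card B)"
      using mult_left_mono[OF T(2), of "real N"] c cT by (simp add: field_simps)
    then have "ln (real N / real (card T)) \<le> ln (2 * real N * KA ^ k / real (card B))"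
      using N cT by (intro ln_mono) auto
    then show ?thesis using S(2) h3 by linarith
  qed
  have "real M powr real (card S) \<le> real M powr d" using pos Sd by (intro powr_mono) auto
  moreover have "real (M ^ card S) = real M powr real (card S)" using pos by (simp add: powr_realpow)
  ultimately have "real (M ^ card S) < real N" using h5 by linarith
  then have "M ^ card S < N" by (simp only: of_nat_less_iff)
  from simultaneous_approximation[OF S(1) pos(4) this]
  obtain t where t: "0 < t" "t < int N" "\<And>l. l \<in> S \<Longrightarrow> norm (ec N (l * t) - 1) \<le> 2 * pi / real M" by blast
  have nt: "\<not> int N dvd t" using t by (auto dest: zdvd_imp_le)
  define g where "g = smooth m T f"
  \<comment> \<open>Outside the large spectrum the power \<open>2 * m\<close> makes the coefficient small; inside it the
    character is close to \<open>1\<close> at \<open>j * t\<close>.\<close>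
  have gclose: "\<bar>g (x + int j * t) - g x\<bar> \<le> beta / 16" if j: "j < L" for x j
  proof -
    define ep where "ep = beta / (16 * sqrt KA)"
    have "\<bar>g (x + int j * t) - g x\<bar> \<le> ep * sqrt (real (card B) / real (card A))"
      unfolding g_def f_def
    proof (rule smooth_conv_close[OF N fin finT ne neT inj])
      fix r assume r: "r \<in> {0..<int N}"
      let ?h = "norm (ft N T r) / real (card T)"
      let ?q = "norm (ec N (r * (int j * t)) - 1)"
      have h: "0 \<le> ?h" "?h \<le> 1" using cT norm_ft_le[of N T r] by (auto simp: divide_le_eq)
      show "?h ^ (2 * m) * ?q \<le> ep"
      proof (cases "real (card T) / 2 \<le> norm (ft N T r)")
        case True
        have "?q \<le> (\<Sum>l\<in>S. norm (ec N (l * (int j * t)) - 1))" by (rule Sspec[OF r True])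
        also have "\<dots> \<le> (\<Sum>l\<in>S. real L * (2 * pi / real M))"
        proof (rule sum_mono)
          fix l assume l: "l \<in> S"
          have "norm (ec N (l * (int j * t)) - 1) = norm (ec N (int j * (l * t)) - 1)" by (simp add: mult_ac)
          also have "\<dots> \<le> real j * norm (ec N (l * t) - 1)" by (rule norm_ec_minus_1_mult)
          also have "\<dots> \<le> real L * (2 * pi / real M)" using j t(3)[OF l] by (intro mult_mono) auto
          finally show "norm (ec N (l * (int j * t)) - 1) \<le> real L * (2 * pi / real M)" .
        qed
        also have "\<dots> = real (card S) * (real L * (2 * pi / real M))" by simp
        also have "\<dots> \<le> d * (real L * (2 * pi / real M))" by (intro mult_right_mono Sd) auto
        also have "\<dots> \<le> ep"
          using h4 pos KA1 KB1 by (simp add: ep_def beta_def field_simps)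
        finally have "?q \<le> ep" .
        moreover have "?h ^ (2 * m) * ?q \<le> 1 * ?q" using h by (intro mult_right_mono power_le_one) auto
        ultimately show ?thesis by simp
      next
        case False
        then have "?h \<le> 1 / 2" using cT by (simp add: field_simps)
        then have "?h ^ (2 * m) \<le> (1 / 2) ^ (2 * m)" using h by (intro power_mono) auto
        moreover have "?q \<le> 2" using norm_triangle_ineq4[of "ec N (r * (int j * t))" 1] by simp
        ultimately have "?h ^ (2 * m) * ?q \<le> (1 / 2) ^ (2 * m) * 2" using h by (intro mult_mono) auto
        also have "\<dots> = 2 / 4 ^ m" by (simp add: power_mult power_divide)
        also have "\<dots> \<le> ep" using h1 KA1 KB1 by (simp add: ep_def beta_def field_simps)
        finally show ?thesis .
      qed
    qed
    also have "\<dots> \<le> ep * sqrt KA"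
    proof -
      have "real (card B) / real (card A) \<le> KA" using AB KA c by (simp add: divide_le_eq)
      then show ?thesis using beta KA1 by (intro mult_left_mono real_sqrt_le_mono) (auto simp: ep_def)
    qed
    also have "\<dots> = beta / 16" using KA1 by (simp add: ep_def)
    finally show ?thesis .
  qed
  \<comment> \<open>Some \<open>x \<in> P\<close> has none of its first \<open>L\<close> translates in \<open>E\<close>.\<close>
  define Q where "Q j = {x \<in> {0..<int N}. real (u (x + int j * t)) > beta / 64 * real (card W)}" for j :: nat
  have cQ: "card (Q j) = card E" for j
    unfolding Q_def E_def by (rule card_periodic_shift[OF N]) (simp add: peru)
  have finQ: "finite (\<Union>j<L. Q j)" by (rule finite_subset[of _ "{0..<int N}"]) (auto simp: Q_def)
  have "card (\<Union>j<L. Q j) \<le> (\<Sum>j<L. card (Q j))" by (rule card_UN_le) simp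
  also have "\<dots> = L * card E" by (simp add: cQ)
  also have "\<dots> < card P" using LE by (simp flip: of_nat_mult)
  finally have "\<not> P \<subseteq> (\<Union>j<L. Q j)" using card_mono[OF finQ] by (meson not_le)
  then obtain x where x: "x \<in> P" "x \<notin> (\<Union>j<L. Q j)" by blast
  have good: "real (u (x + int j * t)) \<le> beta / 64 * real (card W)" if "j < L" for j
  proof -
    have "x \<notin> Q j" using x(2) that by blast
    then show ?thesis using x(1) by (auto simp: Q_def P_def)
  qed
  have split: "(\<Sum>w\<in>W. h w) = (\<Sum>w\<in>{w \<in> W. ?bad w z}. h w) + (\<Sum>w\<in>W - {w \<in> W. ?bad w z}. h w)"
    for h :: "_ \<Rightarrow> real" and z
    using finW by (subst add.commute, intro sum.subset_diff) auto
  have cgood: "real (card (W - {w \<in> W. ?bad w z})) = real (card W) - real (u z)" for z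
  proof -
    have "card {w \<in> W. ?bad w z} \<le> card W" using finW by (intro card_mono) auto
    then show ?thesis using finW by (simp add: card_Diff_subset u_def of_nat_diff)
  qed
  have gW: "g z * real (card W) = (\<Sum>w\<in>W. f (z + endpoint m w))" for z
    using cW by (simp add: g_def smooth_def W_def)
  have big: "15 * beta / 64 \<le> g x"
  proof -
    have sb: "sqrt beta / 2 \<le> sqrt (f x) - sqrt beta / 8"
    proof -
      have "sqrt beta * (7 / 10) = sqrt (beta * (49 / 100))"
        by (simp add: real_sqrt_mult real_sqrt_divide)
      also have "\<dots> \<le> sqrt (f x)" using x(1) beta by (intro real_sqrt_le_mono) (simp add: P_def)
      finally have "sqrt beta * (7 / 10) \<le> sqrt (f x)" .
      moreover have "sqrt beta \<ge> 0" using beta by simp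
      ultimately show ?thesis by linarith
    qed
    have low: "beta / 4 \<le> f (x + endpoint m w)" if "w \<in> W - {w \<in> W. ?bad w x}" for w
    proof -
      have "\<not> ?bad w x" using that by blast
      then have "sqrt beta / 2 \<le> sqrt (f (x + endpoint m w))" using sb by linarith
      then have "(sqrt beta / 2)\<^sup>2 \<le> (sqrt (f (x + endpoint m w)))\<^sup>2"
        using beta by (intro power_mono) auto
      then show ?thesis using f0 beta by (simp add: power_divide)
    qed
    have "real (u x) \<le> beta / 64 * real (card W)" using good[OF pos(3)] good[of 0] pos by simp
    also have "\<dots> \<le> 1 / 64 * real (card W)" using beta by (intro mult_right_mono) auto
    finally have "63 / 64 * real (card W) \<le> real (card (W - {w \<in> W. ?bad w x}))"
      unfolding cgood by simp
    then have "beta / 4 * (63 / 64 * real (card W)) \<le> beta / 4 * real (card (W - {w \<in> W. ?bad w x}))"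
      using beta by (intro mult_left_mono) auto
    also have "\<dots> = (\<Sum>w\<in>W - {w \<in> W. ?bad w x}. beta / 4)" by simp
    also have "\<dots> \<le> (\<Sum>w\<in>W - {w \<in> W. ?bad w x}. f (x + endpoint m w))" by (intro sum_mono low)
    also have "\<dots> \<le> (\<Sum>w\<in>W. f (x + endpoint m w))" using finW f0 by (intro sum_mono2) auto
    also have "\<dots> = g x * real (card W)" by (simp add: gW)
    finally have "(beta / 4 * (63 / 64)) * real (card W) \<le> g x * real (card W)" by (simp add: mult.assoc)
    then have "beta / 4 * (63 / 64) \<le> g x" using cW by simp
    then show ?thesis using beta by simp
  qed
  have small: "g z \<le> 2 * beta / 64" if z: "f z = 0" "real (u z) \<le> beta / 64 * real (card W)" for z
  proof -
    have up: "f (z + endpoint m w) \<le> beta / 64" if "w \<in> W - {w \<in> W. ?bad w z}" for w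
    proof -
      have "\<not> ?bad w z" using that by blast
      then have "sqrt (f (z + endpoint m w)) \<le> sqrt beta / 8" using z by simp
      then have "(sqrt (f (z + endpoint m w)))\<^sup>2 \<le> (sqrt beta / 8)\<^sup>2"
        using f0 by (intro power_mono) auto
      then show ?thesis using f0 beta by (simp add: power_divide)
    qed
    have "g z * real (card W) = (\<Sum>w\<in>{w \<in> W. ?bad w z}. f (z + endpoint m w))
        + (\<Sum>w\<in>W - {w \<in> W. ?bad w z}. f (z + endpoint m w))" unfolding gW by (rule split)
    also have "\<dots> \<le> (\<Sum>w\<in>{w \<in> W. ?bad w z}. 1) + (\<Sum>w\<in>W - {w \<in> W. ?bad w z}. beta / 64)"
      by (intro add_mono sum_mono f1 up)
    also have "\<dots> = real (u z) + beta / 64 * (real (card W) - real (u z))"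
      using cgood[of z] unfolding u_def by (simp only: sum_constant mult.commute[of "beta / 64"] mult_1_right)
    also have "\<dots> \<le> beta / 64 * real (card W) + beta / 64 * real (card W)"
      using z(2) beta by (intro add_mono mult_left_mono) auto
    finally have "g z * real (card W) \<le> (2 * beta / 64) * real (card W)" by simp
    then show ?thesis using cW by simp
  qed
  show ?thesis
  proof (rule that[OF nt])
    fix j assume j: "j < L"
    have "f (x + int j * t) \<noteq> 0"
    proof
      assume "f (x + int j * t) = 0"
      then have "g (x + int j * t) \<le> 2 * beta / 64" using good[OF j] by (rule small)
      then show False using big gclose[OF j, of x] beta by linarith
    qed
    then show "\<exists>a\<in>A. \<exists>b\<in>B. int N dvd (x + int j * t) - (a + b)"
      using conv_pos_iff[OF fin(1), of N B "x + int j * t"] by (simp add: f_def algebra_simps)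
  qed
qed

section \<open>Progressions in sumsets of integers\<close>
text \<open>Progressions modulo \<open>N\<close> in the model are pulled back: vanishing second differences transfer to the
  integers. The factors \<open>4\<close> come from passing to a quarter of each set.\<close>
lemma progression_in_sumset:
  fixes A B :: "int set" and KA KB d :: real and m k M L :: nat
  defines "n \<equiv> real (card (A + B))"
  assumes fin: "finite A" "finite B" and ne: "A \<noteq> {}" "B \<noteq> {}"
    and KA: "n \<le> KA * real (card A)" and KB: "n \<le> KB * real (card B)"
    and pos: "m > 0" "k > 0" "L > 0" "M > 0"
    and h1: "32 * sqrt (4 * KA) * (4 * KB) \<le> 4 ^ m"
    and h2: "1024 * real L * real m * (4 * KB)\<^sup>2 < exp (real k / (256 * (real m)\<^sup>2 * (4 * KB)))"
    and h3: "16 * ln (8 * KA ^ 6 * KB ^ 6 * (4 * KA) ^ k) \<le> d"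
    and h4: "32 * pi * d * real L * sqrt (4 * KA) * (4 * KB) \<le> real M"
    and h5: "real M powr d < n"
  shows "\<exists>P. is_arith_prog P L \<and> P \<subseteq> A + B"
proof -
  let ?S = "\<lambda>a1 b1 a2 b2 a3 b3 a4 b4 :: int. (a1 + b1) - (a2 + b2) + ((a3 + b3) - (a4 + b4))"
  define U where "U = A + A + B + B"
  define N where "N = card ((\<lambda>(u, v). u - v) ` (U \<times> U))"
  have finU: "finite U" using fin unfolding U_def by (intro finite_set_plus)
  have c: "real (card A) > 0" "real (card B) > 0" using fin ne by (auto simp: card_gt_0_iff)
  have AB: "real (card A) \<le> n" "real (card B) \<le> n"
    using card_le_card_plus fin ne by (auto simp: n_def)
  have "1 * real (card A) \<le> KA * real (card A)" "1 * real (card B) \<le> KB * real (card B)"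
    using KA KB AB by linarith+
  then have KA1: "KA \<ge> 1" and KB1: "KB \<ge> 1" using c by (simp_all only: mult_le_cancel_right_pos)
  have Nn: "n \<le> real N"
  proof -
    obtain a b where ab: "a \<in> A" "b \<in> B" using ne by auto
    have "(\<lambda>s. s - (a + b)) ` (A + B) \<subseteq> (\<lambda>(u, v). u - v) ` (U \<times> U)"
    proof
      fix z assume "z \<in> (\<lambda>s. s - (a + b)) ` (A + B)"
      then obtain a' b' where z: "a' \<in> A" "b' \<in> B" "z = a' + b' - (a + b)" by (auto elim!: set_plus_elim)
      have "a + a' + b + b' \<in> U" "a + a + b + b \<in> U" unfolding U_def by (intro set_plus_intro ab z)+
      moreover have "z = (a + a' + b + b') - (a + a + b + b)" using z by simp
      ultimately show "z \<in> (\<lambda>(u, v). u - v) ` (U \<times> U)" by blast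
    qed
    then have "card ((\<lambda>s. s - (a + b)) ` (A + B)) \<le> N"
      unfolding N_def using finU by (intro card_mono) auto
    moreover have "card ((\<lambda>s. s - (a + b)) ` (A + B)) = card (A + B)" by (rule card_image) auto
    ultimately show ?thesis by (simp add: n_def)
  qed
  have N0: "N > 0" using Nn AB c by (metis gr0I less_le_trans not_less of_nat_0)
  have NB: "real N \<le> KA ^ 6 * KB ^ 6 * real (card B)"
    unfolding N_def U_def using card_double_sumset_differences[OF fin ne] KA KB by (simp add: n_def)
  obtain A' B' and psi :: "int \<Rightarrow> int" where
    sub: "A' \<subseteq> A" "B' \<subseteq> B" and size: "card A \<le> 4 * card A'" "card B \<le> 4 * card B'"
    and hom: "\<And>a1 a2 a3 a4 b1 b2 b3 b4.
       \<lbrakk>{a1, a2, a3, a4} \<subseteq> A'; {b1, b2, b3, b4} \<subseteq> B'; ?S a1 b1 a2 b2 a3 b3 a4 b4 = 0\<rbrakk> \<Longrightarrow>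
       ?S (psi a1) (psi b1) (psi a2) (psi b2) (psi a3) (psi b3) (psi a4) (psi b4) = 0"
    and iso: "\<And>a1 a2 a3 a4 b1 b2 b3 b4.
       \<lbrakk>{a1, a2, a3, a4} \<subseteq> A'; {b1, b2, b3, b4} \<subseteq> B';
        int N dvd ?S (psi a1) (psi b1) (psi a2) (psi b2) (psi a3) (psi b3) (psi a4) (psi b4)\<rbrakk> \<Longrightarrow>
       ?S a1 b1 a2 b2 a3 b3 a4 b4 = 0"
    by (rule ruzsa_model[OF fin ne, of N]) (simp add: N_def U_def, blast)
  have size': "real (card A) \<le> 4 * real (card A')" "real (card B) \<le> 4 * real (card B')"
    using size by linarith+
  have fin': "finite A'" "finite B'" using sub fin finite_subset by blast+
  have "card A' > 0" "card B' > 0" using size' c by linarith+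
  then have ne': "A' \<noteq> {}" "B' \<noteq> {}" by auto
  have injA: "a = a'" if "a \<in> A'" "a' \<in> A'" "int N dvd psi a - psi a'" for a a'
  proof -
    obtain b where "b \<in> B'" using ne' by auto
    then show ?thesis using iso[of a a' a a b b b b] that by simp
  qed
  have injB: "b = b'" if "b \<in> B'" "b' \<in> B'" "int N dvd psi b - psi b'" for b b'
  proof -
    obtain a where "a \<in> A'" using ne' by auto
    then show ?thesis using iso[of a a a a b b' b b] that by simp
  qed
  have cA': "card (psi ` A') = card A'" using injA by (intro card_image inj_onI) auto
  have cB': "card (psi ` B') = card B'" using injB by (intro card_image inj_onI) auto
  have inj: "inj_on (\<lambda>x. x mod int N) (psi ` A')" "inj_on (\<lambda>x. x mod int N) (psi ` B')"
    using injA injB by (auto simp: inj_on_def mod_eq_dvd_iff)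
  have eqS: "psi a + psi b = psi a' + psi b'"
    if "a \<in> A'" "a' \<in> A'" "b \<in> B'" "b' \<in> B'" "a + b = a' + b'" for a a' b b'
    using hom[of a a' a a b b' b b] that by simp
  have n': "card (psi ` A' + psi ` B') \<le> card (A + B)"
  proof -
    have "\<exists>h. \<forall>s\<in>psi ` A' + psi ` B'. \<exists>a\<in>A'. \<exists>b\<in>B'. s = psi a + psi b \<and> h s = a + b"
      by (rule bchoice) (auto elim!: set_plus_elim)
    then obtain h where h: "\<And>s. s \<in> psi ` A' + psi ` B' \<Longrightarrow> \<exists>a\<in>A'. \<exists>b\<in>B'. s = psi a + psi b \<and> h s = a + b"
      by blast
    have "inj_on h (psi ` A' + psi ` B')"
    proof (rule inj_onI)
      fix s s' assume s: "s \<in> psi ` A' + psi ` B'" "s' \<in> psi ` A' + psi ` B'" "h s = h s'"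
      obtain a b where 1: "a \<in> A'" "b \<in> B'" "s = psi a + psi b" "h s = a + b" using h[OF s(1)] by blast
      obtain a' b' where 2: "a' \<in> A'" "b' \<in> B'" "s' = psi a' + psi b'" "h s' = a' + b'" using h[OF s(2)] by blast
      show "s = s'" using eqS[of a a' b b'] 1 2 s(3) by simp
    qed
    moreover have "h ` (psi ` A' + psi ` B') \<subseteq> A + B"
    proof
      fix z assume "z \<in> h ` (psi ` A' + psi ` B')"
      then obtain s where "s \<in> psi ` A' + psi ` B'" "z = h s" by blast
      then obtain a b where "a \<in> A'" "b \<in> B'" "z = a + b" using h by metis
      then show "z \<in> A + B" using sub by auto
    qed
    ultimately show ?thesis using fin by (intro card_inj_on_le[of h] finite_set_plus)
  qed
  have K': "real (card (psi ` A' + psi ` B')) \<le> 4 * KA * real (card (psi ` A'))"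
    "real (card (psi ` A' + psi ` B')) \<le> 4 * KB * real (card (psi ` B'))"
  proof -
    have "real (card (psi ` A' + psi ` B')) \<le> n" using n' by (simp add: n_def)
    moreover have "KA * real (card A) \<le> KA * (4 * real (card A'))" "KB * real (card B) \<le> KB * (4 * real (card B'))"
      using size' KA1 KB1 by (intro mult_left_mono; simp)+
    ultimately show "real (card (psi ` A' + psi ` B')) \<le> 4 * KA * real (card (psi ` A'))"
      "real (card (psi ` A' + psi ` B')) \<le> 4 * KB * real (card (psi ` B'))"
      using KA KB unfolding cA' cB' by linarith+
  qed
  have h3': "16 * ln (2 * real N * (4 * KA) ^ k / real (card (psi ` B'))) \<le> d"
  proof -
    have p: "real (card B') > 0" using size' c by linarith
    have "real N \<le> KA ^ 6 * KB ^ 6 * (4 * real (card B'))"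
      by (rule order_trans[OF NB], intro mult_left_mono size') (use KA1 KB1 in auto)
    then have "real N / real (card B') \<le> 4 * KA ^ 6 * KB ^ 6" using p by (simp add: pos_divide_le_eq mult_ac)
    then have "2 * (4 * KA) ^ k * (real N / real (card B')) \<le> 2 * (4 * KA) ^ k * (4 * KA ^ 6 * KB ^ 6)"
      using KA1 by (intro mult_left_mono) auto
    then have "2 * real N * (4 * KA) ^ k / real (card B') \<le> 8 * KA ^ 6 * KB ^ 6 * (4 * KA) ^ k"
      by (simp add: mult_ac)
    moreover have "2 * real N * (4 * KA) ^ k / real (card B') > 0"
      using p N0 KA1 by (intro divide_pos_pos mult_pos_pos) auto
    ultimately have "ln (2 * real N * (4 * KA) ^ k / real (card B')) \<le> ln (8 * KA ^ 6 * KB ^ 6 * (4 * KA) ^ k)"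
      by (intro ln_mono) auto
    then show ?thesis using h3 unfolding cB' by linarith
  qed
  have h5': "real M powr d < real N" using h5 Nn by linarith
  obtain t y where t: "\<not> int N dvd t"
    and ty: "\<And>j. j < L \<Longrightarrow> \<exists>a\<in>psi ` A'. \<exists>b\<in>psi ` B'. int N dvd (y + int j * t) - (a + b)"
    using progression_mod_N[OF N0 finite_imageI[OF fin'(1)] finite_imageI[OF fin'(2)] _ _ inj K' pos h1 h2 h3' h4 h5']
      ne' by blast
  have "\<forall>j\<in>{..<L}. \<exists>p. p \<in> A' \<times> B' \<and> int N dvd (y + int j * t) - (psi (fst p) + psi (snd p))"
    using ty by fastforce
  then obtain p where p: "\<And>j. j < L \<Longrightarrow> p j \<in> A' \<times> B' \<and> int N dvd (y + int j * t) - (psi (fst (p j)) + psi (snd (p j)))"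
    by (metis bchoice lessThan_iff)
  define a where "a j = fst (p j)" for j
  define b where "b j = snd (p j)" for j
  have ab: "a j \<in> A'" "b j \<in> B'" "int N dvd (y + int j * t) - (psi (a j) + psi (b j))" if "j < L" for j
    using p[OF that] by (auto simp: a_def b_def mem_Times_iff)
  \<comment> \<open>For \<open>L = 1\<close> the common difference is arbitrary.\<close>
  define D where "D = (if L = 1 then 1 else (a 1 + b 1) - (a 0 + b 0))"
  have D0: "D \<noteq> 0"
  proof (cases "L = 1")
    case False
    then have L: "0 < L" "1 < L" using pos(3) by auto
    show ?thesis
    proof
      assume "D = 0"
      then have "a 1 + b 1 = a 0 + b 0" using False by (simp add: D_def)
      then have "psi (a 1) + psi (b 1) = psi (a 0) + psi (b 0)" using ab L by (intro eqS) auto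
      moreover have "int N dvd ((y + int 1 * t) - (psi (a 1) + psi (b 1))) - ((y + int 0 * t) - (psi (a 0) + psi (b 0)))"
        by (rule dvd_diff[OF ab(3)[OF L(2)] ab(3)[OF L(1)]])
      ultimately show False using t by simp
    qed
  qed (simp add: D_def)
  have second: "(a (Suc (Suc j)) + b (Suc (Suc j))) - (a (Suc j) + b (Suc j)) = (a (Suc j) + b (Suc j)) - (a j + b j)"
    if j: "Suc (Suc j) < L" for j
  proof -
    let ?x = "\<lambda>i. y + int i * t" and ?s = "\<lambda>i. psi (a i) + psi (b i)"
    have "int N dvd ((?x (Suc j) - ?s (Suc j)) - (?x (Suc (Suc j)) - ?s (Suc (Suc j))))
        + ((?x (Suc j) - ?s (Suc j)) - (?x j - ?s j))"
      by (rule dvd_add[OF dvd_diff[OF ab(3) ab(3)] dvd_diff[OF ab(3) ab(3)]]) (use j in auto)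
    also have "((?x (Suc j) - ?s (Suc j)) - (?x (Suc (Suc j)) - ?s (Suc (Suc j))))
        + ((?x (Suc j) - ?s (Suc j)) - (?x j - ?s j))
        = ?S (psi (a (Suc (Suc j)))) (psi (b (Suc (Suc j)))) (psi (a (Suc j))) (psi (b (Suc j)))
            (psi (a j)) (psi (b j)) (psi (a (Suc j))) (psi (b (Suc j)))"
      by (simp add: algebra_simps)
    finally have "?S (a (Suc (Suc j))) (b (Suc (Suc j))) (a (Suc j)) (b (Suc j)) (a j) (b j) (a (Suc j)) (b (Suc j)) = 0"
      using ab(1,2) j by (intro iso) auto
    then show ?thesis by simp
  qed
  have diff: "(a (Suc j) + b (Suc j)) - (a j + b j) = D" if "Suc j < L" for j
    using that
  proof (induction j)
    case 0
    then show ?case by (simp add: D_def)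
  next
    case (Suc j)
    then show ?case using second[of j] by simp
  qed
  have points: "a j + b j = (a 0 + b 0) + int j * D" if "j < L" for j
    using that
  proof (induction j)
    case (Suc j)
    then show ?case using diff[of j] by (simp add: algebra_simps)
  qed simp
  show ?thesis
  proof (intro exI conjI)
    show "is_arith_prog {(a 0 + b 0) + int i * D | i. i < L} L"
      unfolding is_arith_prog_def using D0 by blast
    show "{(a 0 + b 0) + int i * D | i. i < L} \<subseteq> A + B"
      using points ab(1,2) sub by (force intro!: set_plus_intro simp flip: points)
  qed
qed

lemma ln_2_ge: "3 / 5 \<le> ln (2 :: real)"
proof -
  have "exp (3 / 5 :: real) ^ 5 = exp 1 ^ 3" by (simp flip: exp_of_nat_mult)
  also have "\<dots> \<le> 3 ^ 3" using exp_le by (intro power_mono) auto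
  also have "\<dots> \<le> (2 :: real) ^ 5" by simp
  finally have "exp (3 / 5 :: real) \<le> 2" by (rule power_le_imp_le_base[of _ 4, simplified]) simp
  then show ?thesis by (subst ln_ge_iff) auto
qed

lemma exp_ge_power: "(5 / 2) ^ j \<le> exp (real j * Z)" if "Z \<ge> 1" for Z :: real
proof -
  have "5 / 2 \<le> exp (1 :: real)" using exp_lower_Taylor_quadratic[of 1] by simp
  also have "\<dots> \<le> exp Z" using that by simp
  finally have "(5 / 2) ^ j \<le> exp Z ^ j" by (intro power_mono) auto
  then show ?thesis by (simp flip: exp_of_nat_mult)
qed

text \<open>The choice of parameters. With \<open>H = ln (2 KA KB)\<close>, take \<open>m\<close> of order \<open>H\<close>, \<open>k\<close> of order
  \<open>m\<^sup>2 KB Z\<close> and \<open>d\<close> of order \<open>KB ln (2 KA) H\<^sup>2 Z\<close>. The bounds by \<open>exp Z\<close> on \<open>KA\<close>, \<open>KB\<close> and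
  \<open>ln n\<close> keep \<open>L\<close>, \<open>m\<close>, \<open>d\<close> and hence \<open>M\<close> below bounded powers of \<open>exp Z\<close>; in particular \<open>ln M\<close> is at
  most \<open>13 Z\<close>, so that \<open>10 ^ 9\<close> exceeds \<open>13\<close> times the constant \<open>7 * 10 ^ 7\<close> of \<open>d\<close>, which gives \<open>h5\<close>.\<close>
lemma long_progression_if_sumset_large:
  fixes A B :: "int set" and KA KB Z :: real
  defines "n \<equiv> real (card (A + B))"
  assumes fin: "finite A" "finite B" and ne: "A \<noteq> {}" "B \<noteq> {}"
    and KA: "n \<le> KA * real (card A)" and KB: "n \<le> KB * real (card B)"
    and Z: "Z \<ge> 1" and KAZ: "KA \<le> exp Z" and KBZ: "KB \<le> exp Z" and nZ: "ln n \<le> exp Z"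
    and large: "10 ^ 9 * (KB * ln (2 * KA) * (ln (2 * KA * KB))\<^sup>2) * Z\<^sup>2 \<le> ln n"
  shows "\<exists>P L. is_arith_prog P L \<and> P \<subseteq> A + B \<and> real L \<ge> exp Z"
proof -
  have c: "real (card A) > 0" "real (card B) > 0" using fin ne by (auto simp: card_gt_0_iff)
  have AB: "real (card A) \<le> n" "real (card B) \<le> n"
    using card_le_card_plus fin ne by (auto simp: n_def)
  have n0: "n > 0" using AB c by linarith
  have "1 * real (card A) \<le> KA * real (card A)" "1 * real (card B) \<le> KB * real (card B)"
    using KA KB AB by linarith+
  then have KA1: "KA \<ge> 1" and KB1: "KB \<ge> 1" using c by (simp_all only: mult_le_cancel_right_pos)
  define l where "l = ln (2 * KA)"
  define H where "H = ln (2 * KA * KB)"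
  define W where "W = KB * l * H\<^sup>2"
  have l_eq: "l = ln 2 + ln KA" and H_eq: "H = ln 2 + ln KA + ln KB"
    using KA1 KB1 by (simp_all add: l_def H_def ln_mult)
  have lnK: "ln KA \<ge> 0" "ln KB \<ge> 0" using KA1 KB1 by auto
  have lnK': "ln KA \<le> Z" "ln KB \<le> Z"     using ln_mono[OF KAZ] ln_mono[OF KBZ] KA1 KB1 by auto
  have l2: "l \<ge> 1 / 2" and H2: "H \<ge> 1 / 2" using l_eq H_eq lnK ln_2_ge by linarith+
  have ln2: "ln (2 :: real) \<le> 1" using ln_le_minus_one[of "2 :: real"] by simp
  have HZ: "H \<le> 3 * Z" using H_eq lnK' ln2 Z by linarith
  have eZ: "exp Z \<ge> 1" "Z \<le> exp Z" using Z exp_ge_add_one_self[of Z] by linarith+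
  have e4: "exp (4 * Z) = exp Z ^ 4" by (simp flip: exp_of_nat_mult)
  have W0: "W > 0" using KB1 l2 H2 by (simp add: W_def)
  have large': "10 ^ 9 * W * Z\<^sup>2 \<le> ln n" using large by (simp add: W_def l_def H_def)
  define m where "m = nat \<lceil>8 * H\<rceil>"
  have m: "8 * H \<le> real m" "real m \<le> 10 * H" "m > 0" using H2 unfolding m_def by linarith+
  have mZ: "real m \<le> 30 * exp Z" using m HZ eZ by linarith
  define L where "L = nat \<lceil>exp Z\<rceil>"
  have L: "exp Z \<le> real L" "real L \<le> 2 * exp Z" "L > 0" using eZ unfolding L_def by linarith+
  define k where "k = nat \<lceil>20480 * (real m)\<^sup>2 * KB * Z\<rceil> + 1"
  have k0: "20480 * (real m)\<^sup>2 * KB * Z \<ge> 0" using KB1 Z by simp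
  have k: "20480 * (real m)\<^sup>2 * KB * Z \<le> real k" "real k \<le> 20480 * (real m)\<^sup>2 * KB * Z + 2" "k > 0"
    using k0 unfolding k_def by linarith+
  define d where "d = 7 * 10 ^ 7 * W * Z"
  have d0: "d > 0" using W0 Z by (simp add: d_def)
  define M where "M = nat \<lceil>32 * pi * d * real L * sqrt (4 * KA) * (4 * KB)\<rceil>"
  have M0: "32 * pi * d * real L * sqrt (4 * KA) * (4 * KB) > 0"
    using d0 L KA1 KB1 by (intro mult_pos_pos) auto
  have M: "32 * pi * d * real L * sqrt (4 * KA) * (4 * KB) \<le> real M"
    "real M \<le> 32 * pi * d * real L * sqrt (4 * KA) * (4 * KB) + 1" "M > 0"
    using M0 unfolding M_def by linarith+
  have sq: "sqrt (4 * KA) \<le> 2 * KA"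
  proof -
    have "4 * KA \<le> (2 * KA)\<^sup>2" using KA1 by (simp add: power2_eq_square)
    then show ?thesis by (rule real_le_lsqrt[rotated]) (use KA1 in simp)
  qed
  have h1: "32 * sqrt (4 * KA) * (4 * KB) \<le> 4 ^ m"
  proof -
    have Q: "KA * KB \<ge> 1" using KA1 KB1 by (metis mult_mono' mult_1 zero_le_one)
    have "32 * sqrt (4 * KA) * (4 * KB) \<le> 32 * (2 * KA) * (4 * KB)"
      using sq KB1 by (intro mult_right_mono mult_left_mono) auto
    also have "\<dots> = 2 ^ 8 * (KA * KB) ^ 1" by simp
    also have "\<dots> \<le> 2 ^ 8 * (KA * KB) ^ 8" using Q by (intro mult_left_mono power_increasing) auto
    also have "\<dots> = exp (8 * H)"
    proof -
      have "exp (8 * H) = exp H ^ 8" by (simp flip: exp_of_nat_mult)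
      also have "exp H = 2 * KA * KB" using KA1 KB1 by (simp add: H_def)
      finally show ?thesis by (simp add: power_mult_distrib)
    qed
    also have "\<dots> \<le> exp (real m)" using m by simp
    also have "\<dots> = exp 1 ^ m" by (simp flip: exp_of_nat_mult)
    also have "\<dots> \<le> 4 ^ m" using exp_le by (intro power_mono) auto
    finally show ?thesis .
  qed
  have h2: "1024 * real L * real m * (4 * KB)\<^sup>2 < exp (real k / (256 * (real m)\<^sup>2 * (4 * KB)))"
  proof -
    have "1024 * real L * real m * (4 * KB)\<^sup>2 \<le> 1024 * (2 * exp Z) * (30 * exp Z) * (4 * exp Z)\<^sup>2"
      using L mZ KBZ KB1 by (intro mult_mono power_mono) auto
    also have "\<dots> = 983040 * exp (4 * Z)"
      by (simp add: e4 power2_eq_square power4_eq_xxxx)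
    also have "\<dots> < (5 / 2) ^ 16 * exp (4 * Z)"
      by (intro mult_strict_right_mono) (auto simp: power_divide)
    also have "\<dots> \<le> exp (real 16 * Z) * exp (4 * Z)"
      by (intro mult_right_mono exp_ge_power Z) auto
    also have "\<dots> = exp (20 * Z)" by (simp flip: exp_add)
    also have "\<dots> \<le> exp (real k / (256 * (real m)\<^sup>2 * (4 * KB)))"
      using k(1) m(3) KB1 by (simp add: pos_le_divide_eq mult_ac)
    finally show ?thesis .
  qed
  have h3: "16 * ln (8 * KA ^ 6 * KB ^ 6 * (4 * KA) ^ k) \<le> d"
  proof -
    have ln8: "ln (8 :: real) = 3 * ln 2" using ln_realpow[of 2 3] by simp
    have ln4: "ln (4 * KA) \<le> 2 * l" using KA1 lnK ln_realpow[of 2 2] by (simp add: ln_mult l_eq)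
    have "ln (8 * KA ^ 6 * KB ^ 6 * (4 * KA) ^ k) = 3 * ln 2 + 6 * ln KA + 6 * ln KB + real k * ln (4 * KA)"
      using KA1 KB1 by (simp add: ln_mult ln_realpow ln8 distrib_left)
    also have "\<dots> \<le> 6 * H + real k * (2 * l)"
      using ln4 ln_2_ge unfolding H_eq by (intro add_mono mult_left_mono) auto
    finally have 1: "16 * ln (8 * KA ^ 6 * KB ^ 6 * (4 * KA) ^ k) \<le> 96 * H + 32 * (real k * l)" by simp
    have HH: "H\<^sup>2 \<ge> 1 / 4" using power_mono[OF H2, of 2] by (simp add: power2_eq_square)
    have one: "1 \<le> KB * Z" using KB1 Z by (metis mult_mono' mult_1 zero_le_one)
    have KZ: "1 \<le> 4 * (KB * Z * H\<^sup>2)"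
      using mult_mono[OF one HH] one by simp
    have "(real m)\<^sup>2 \<le> (10 * H)\<^sup>2" using m by (intro power_mono) auto
    then have "20480 * (KB * Z) * (real m)\<^sup>2 \<le> 20480 * (KB * Z) * (10 * H)\<^sup>2"
      using one by (intro mult_left_mono) auto
    then have "real k \<le> 2048000 * (KB * Z * H\<^sup>2) + 2" using k(2) by (simp add: power_mult_distrib mult_ac)
    then have "real k \<le> 2048008 * (KB * Z * H\<^sup>2)" using KZ by linarith
    then have "real k * l \<le> 2048008 * (KB * Z * H\<^sup>2) * l" using l2 by (intro mult_right_mono) auto
    then have kl: "real k * l \<le> 2048008 * (W * Z)" by (simp add: W_def mult_ac)
    have "1 \<le> (2 * H) * (2 * l)" using H2 l2 mult_mono[of 1 "2 * H" 1 "2 * l"] by simp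
    then have "1 * 1 \<le> ((2 * H) * (2 * l)) * (KB * Z)" using one by (intro mult_mono) auto
    then have "H * (1 * 1) \<le> H * (((2 * H) * (2 * l)) * (KB * Z))" using H2 by (intro mult_left_mono) auto
    then have "H \<le> 4 * (W * Z)" by (simp add: W_def power2_eq_square mult_ac)
    moreover have "W * Z > 0" using W0 Z by simp
    ultimately have "96 * H + 32 * (real k * l) \<le> 70000000 * (W * Z)" using kl by linarith
    then show ?thesis using 1 by (simp add: d_def mult.assoc)
  qed
  have dZ: "d * Z \<le> 7 / 100 * ln n" using large' by (simp add: d_def power2_eq_square mult_ac)
  have ln0: "ln n > 0" using large' W0 Z by (smt (verit) mult_pos_pos zero_less_power)
  have dle: "d \<le> exp Z"
  proof -
    have "d * 1 \<le> d * Z" using d0 Z by (intro mult_left_mono) auto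
    then show ?thesis using dZ nZ ln0 by linarith
  qed
  have Mle: "real M \<le> exp (13 * Z)"
  proof -
    have "32 * pi * d * real L * sqrt (4 * KA) * (4 * KB)
        \<le> 32 * 4 * exp Z * (2 * exp Z) * (2 * exp Z) * (4 * exp Z)"
      using pi_less_4 dle L sq KAZ KBZ KA1 KB1 d0 by (intro mult_mono) auto
    also have "\<dots> = 2048 * exp (4 * Z)" by (simp add: e4 power4_eq_xxxx)
    finally have "real M \<le> 2048 * exp (4 * Z) + 1" using M by linarith
    also have "\<dots> \<le> 2049 * exp (4 * Z)"
    proof -
      have "exp (4 * Z) \<ge> 1" using Z by simp
      then show ?thesis by linarith
    qed
    also have "\<dots> \<le> (5 / 2) ^ 9 * exp (4 * Z)"
      by (intro mult_right_mono) (auto simp: power_divide)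
    also have "\<dots> \<le> exp (real 9 * Z) * exp (4 * Z)"
      by (intro mult_right_mono exp_ge_power Z) auto
    also have "\<dots> = exp (13 * Z)" by (simp flip: exp_add)
    finally show ?thesis .
  qed
  have h5: "real M powr d < n"
  proof -
    have "real M powr d \<le> exp (13 * Z) powr d" using Mle d0 by (intro powr_mono2) auto
    also have "\<dots> = exp (13 * (d * Z))" by (simp add: powr_def mult_ac)
    also have "\<dots> < exp (ln n)" using dZ ln0 by simp
    also have "\<dots> = n" using n0 by simp
    finally show ?thesis .
  qed
  obtain P where "is_arith_prog P L" "P \<subseteq> A + B"
    using progression_in_sumset[OF fin ne KA[unfolded n_def] KB[unfolded n_def] m(3) k(3) L(3) M(3)
        h1 h2 h3 M(1) h5[unfolded n_def]] by blast
  then show ?thesis using L(1) by blast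
qed

text \<open>When \<open>y = KB\<close> exceeds the square of \<open>x = KA\<close>, exchanging the two sets makes the weight of the
  large constant logarithmic. With \<open>v = root 6 y\<close> one has \<open>x \<le> v ^ 3\<close>, and each of the three
  logarithmic factors is at most linear in \<open>v\<close>.\<close>
lemma swapped_rank_bound:
  fixes x y :: real
  assumes x: "x \<ge> 1" and xy: "x\<^sup>2 < y"
  shows "x * ln (2 * y) * (ln (2 * y * x))\<^sup>2 \<le> 486 * y"
proof -
  have y1: "y > 1" using xy power_mono[OF x, of 2] by simp
  define v where "v = root 6 y"
  have v: "v ^ 6 = y" "v \<ge> 1" using y1 by (auto simp: v_def)
  have lnv: "ln v \<le> v - 1" using v by (intro ln_le_minus_one) auto
  have ln2: "ln (2 :: real) \<le> 1" using ln_le_minus_one[of "2 :: real"] by simp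
  have "x\<^sup>2 \<le> (v ^ 3)\<^sup>2" using xy v by (simp flip: power_mult)
  then have xv: "x \<le> v ^ 3" using v by (auto intro: power2_le_imp_le)
  have lny: "ln y = 6 * ln v" using v by (simp add: ln_realpow flip: v(1))
  have "ln x \<le> ln (v ^ 3)" using x xv by (intro ln_mono) auto
  then have lnx: "ln x \<le> 3 * ln v" using v by (simp add: ln_realpow)
  have "ln (2 * y) = ln 2 + ln y" using y1 by (simp add: ln_mult)
  then have 1: "ln (2 * y) \<le> 6 * v" using lny lnv ln2 by linarith
  have e: "ln (2 * y * x) = ln 2 + ln y + ln x" using y1 x by (simp add: ln_mult)
  have 2: "ln (2 * y * x) \<le> 9 * v" using e lny lnv ln2 lnx by linarith
  have "1 * 1 \<le> 2 * y * x" using y1 x by (intro mult_mono) auto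
  then have 3: "ln (2 * y) \<ge> 0" "ln (2 * y * x) \<ge> 0" using y1 by auto
  have "x * ln (2 * y) * (ln (2 * y * x))\<^sup>2 \<le> v ^ 3 * (6 * v) * (9 * v)\<^sup>2"
    using x xv 1 2 3 v by (intro mult_mono power_mono) auto
  also have "\<dots> = 486 * v ^ 6" by (simp add: power2_eq_square eval_nat_numeral)
  finally show ?thesis by (simp add: v)
qed

theorem theorem1p4:
  shows "\<exists>c>0. \<forall>(A :: int set) (B :: int set) (K\<^sub>A :: real) (K\<^sub>B :: real).
    finite A \<longrightarrow> A \<noteq> {} \<longrightarrow> finite B \<longrightarrow> B \<noteq> {} \<longrightarrow>
    real (card (A + B)) \<le> K\<^sub>A * real (card A) \<longrightarrow>
    real (card (A + B)) \<le> K\<^sub>B * real (card B) \<longrightarrow>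
    (\<exists>P L. is_arith_prog P L \<and> P \<subseteq> A + B \<and>
       real L \<ge> exp (c * sqrt (ln (real (card (A + B))) / (K\<^sub>B * (ln (2 * K\<^sub>A)) ^ 3))
                     - ln (2 * K\<^sub>A * ln (2 * real (card A)))))"
proof -
  \<comment> \<open>Small enough for \<open>10 ^ 9 * 3888 * 36 * c\<^sup>2 \<le> 1\<close>, which is what the choice \<open>Z = 6 * (c * X)\<close> below needs.\<close>
  define c :: real where "c = 1 / (2 * 10 ^ 7)"
  have goal: "\<exists>P L. is_arith_prog P L \<and> P \<subseteq> A + B \<and>
       real L \<ge> exp (c * sqrt (ln (real (card (A + B))) / (KB * (ln (2 * KA)) ^ 3))
                     - ln (2 * KA * ln (2 * real (card A))))"
    if fin: "finite A" "finite B" and ne: "A \<noteq> {}" "B \<noteq> {}"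
      and KA: "real (card (A + B)) \<le> KA * real (card A)"
      and KB: "real (card (A + B)) \<le> KB * real (card B)" for A B :: "int set" and KA KB :: real
  proof -
    define n where "n = real (card (A + B))"
    define a where "a = real (card A)"
    have c0: "a > 0" "real (card B) > 0" using fin ne by (auto simp: card_gt_0_iff a_def)
    have AB: "a \<le> n" "real (card B) \<le> n"
      using card_le_card_plus fin ne by (auto simp: n_def a_def)
    have a1: "a \<ge> 1" using c0 by (simp add: a_def)
    have n1: "n \<ge> 1" using AB a1 by linarith
    have "1 * a \<le> KA * a" "1 * real (card B) \<le> KB * real (card B)"
      using KA KB AB by (auto simp: n_def a_def)
    then have KA1: "KA \<ge> 1" and KB1: "KB \<ge> 1" using c0 by (simp_all only: mult_le_cancel_right_pos)
    define l where "l = ln (2 * KA)"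
    define X where "X = sqrt (ln n / (KB * l ^ 3))"
    define q where "q = 2 * KA * ln (2 * a)"
    have "l = ln 2 + ln KA" using KA1 by (simp add: l_def ln_mult)
    then have l35: "l \<ge> 3 / 5" using ln_2_ge ln_ge_zero[OF KA1] by linarith
    have "ln (2 * a) = ln 2 + ln a" using a1 by (simp add: ln_mult)
    then have ln2a: "ln (2 * a) \<ge> 3 / 5" using ln_2_ge ln_ge_zero[OF a1] by linarith
    have q: "q \<ge> 6 / 5 * KA" "q \<ge> 2 * ln (2 * a)" "q \<ge> 6 / 5"
    proof -
      have "2 * KA * (3 / 5) \<le> q" unfolding q_def using KA1 ln2a by (intro mult_left_mono) auto
      then show "q \<ge> 6 / 5 * KA" by simp
      then show "q \<ge> 6 / 5" using KA1 by linarith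
      have "2 * 1 * ln (2 * a) \<le> q" unfolding q_def using KA1 ln2a
        by (intro mult_right_mono mult_left_mono) auto
      then show "q \<ge> 2 * ln (2 * a)" by simp
    qed
    have lnq: "ln q \<ge> 1 / 6"
    proof -
      have "ln (1 / q) \<le> 1 / q - 1" using q by (intro ln_le_minus_one) auto
      moreover have "1 / q \<le> 5 / 6" using q(3) by (simp add: field_simps)
      moreover have "ln (1 / q) = - ln q" using q(3) by (simp add: ln_div)
      ultimately show ?thesis by linarith
    qed
    show ?thesis
    proof (cases "c * X \<le> ln q")
      case True
      obtain x y where "x \<in> A" "y \<in> B" using ne by auto
      then have "{x + y} \<subseteq> A + B" by auto
      moreover have "is_arith_prog {x + y} 1"
        unfolding is_arith_prog_def by (rule exI[of _ "x + y"], rule exI[of _ 1]) auto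
      moreover have "real 1 \<ge> exp (c * X - ln q)" using True by simp
      ultimately show ?thesis unfolding X_def n_def l_def q_def a_def by blast
    next
      case False
      \<comment> \<open>The factor \<open>6\<close> makes \<open>Z \<ge> 1\<close> and lets \<open>exp Z\<close> absorb \<open>2 * q\<close>.\<close>
      define Z where "Z = 6 * (c * X)"
      have Zq: "Z \<ge> 6 * ln q" using False by (simp add: Z_def)
      have Z1: "Z \<ge> 1" using Zq lnq by linarith
      have X: "X \<ge> 3" using False lnq by (simp add: c_def)
      have l3: "l ^ 3 \<ge> 27 / 125" using power_mono[OF l35, of 3] by (simp add: power3_eq_cube)
      have "l ^ 3 > 0" using l3 by linarith
      then have den: "KB * l ^ 3 > 0" using KB1 by simp
      have X2: "X\<^sup>2 = ln n / (KB * l ^ 3)" using n1 den by (simp add: X_def)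
      have "KB * l ^ 3 \<noteq> 0" using den by linarith
      from nonzero_eq_divide_eq[OF this] X2 have "X\<^sup>2 * (KB * l ^ 3) = ln n" by blast
      then have lnn: "ln n = X\<^sup>2 * (KB * l ^ 3)" by (rule sym)
      have "q * 2 \<le> q * (6 / 5) ^ 5" using q(3) by (intro mult_left_mono) (auto simp: power_divide)
      also have "\<dots> \<le> q * q ^ 5" using q(3) by (intro mult_left_mono power_mono) auto
      also have "\<dots> = exp (ln q) ^ 6" using q(3) by (simp add: eval_nat_numeral)
      also have "\<dots> = exp (6 * ln q)" by (simp flip: exp_of_nat_mult)
      also have "\<dots> \<le> exp Z" using Zq by simp
      finally have qZ: "q * 2 \<le> exp Z" .
      have KAZ: "KA \<le> exp Z" using qZ q KA1 by linarith
      have lnnZ: "ln n \<le> exp Z"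
      proof -
        have "ln n \<le> ln (KA * a)" using KA n1 by (simp add: n_def a_def)
        also have "\<dots> = ln KA + ln a" using KA1 a1 by (simp add: ln_mult)
        also have "\<dots> \<le> KA + ln (2 * a)" using ln_le_minus_one[of KA] KA1 a1 by (intro add_mono) auto
        also have "\<dots> \<le> q * 2" using q KA1 ln2a by linarith
        finally show ?thesis using qZ by linarith
      qed
      have KBZ: "KB \<le> exp Z"
      proof -
        have "9 \<le> X\<^sup>2" using power_mono[OF X, of 2] by simp
        then have "9 * (27 / 125) \<le> X\<^sup>2 * l ^ 3" using l3 by (intro mult_mono) auto
        then have "KB * 1 \<le> KB * (X\<^sup>2 * l ^ 3)" using KB1 by (intro mult_left_mono) auto
        also have "\<dots> = ln n" by (simp add: lnn)
        finally show ?thesis using lnnZ by simp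
      qed
      have Z2: "Z\<^sup>2 = 36 * c\<^sup>2 * X\<^sup>2" by (simp add: Z_def power_mult_distrib)
      \<comment> \<open>The coefficient of \<open>Z\<^sup>2\<close> required of a long progression may be computed with the two sets
        in either order; here is what it has to satisfy.\<close>
      have suff: "10 ^ 9 * V * Z\<^sup>2 \<le> ln n" if "V \<le> 3888 * (KB * l ^ 3)" for V
      proof -
        have "10 ^ 9 * V * Z\<^sup>2 \<le> 10 ^ 9 * (3888 * (KB * l ^ 3)) * Z\<^sup>2"
          using that by (intro mult_left_mono mult_right_mono) auto
        also have "\<dots> = (10 ^ 9 * 3888 * 36 * c\<^sup>2) * ln n" unfolding Z2 lnn by (simp add: mult_ac)
        also have "\<dots> \<le> 1 * ln n" using n1 by (intro mult_right_mono) (auto simp: c_def power_divide)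
        finally show ?thesis by simp
      qed
      have "\<exists>P L. is_arith_prog P L \<and> P \<subseteq> A + B \<and> real L \<ge> exp Z"
      proof (cases "KB \<le> KA\<^sup>2")
        case True
        have H0: "ln (2 * KA * KB) = l + ln KB" using KA1 KB1 by (simp add: l_def ln_mult)
        have "ln KB \<le> ln (KA\<^sup>2)" using True KB1 by (intro ln_mono) auto
        also have "\<dots> \<le> 2 * l" using KA1 by (simp add: ln_realpow l_def ln_mult)
        finally have H: "ln (2 * KA * KB) \<le> 3 * l" "ln (2 * KA * KB) \<ge> 0"
          using H0 l35 KB1 by auto
        then have "(ln (2 * KA * KB))\<^sup>2 \<le> (3 * l)\<^sup>2" by (intro power_mono)
        then have "KB * l * (ln (2 * KA * KB))\<^sup>2 \<le> KB * l * (3 * l)\<^sup>2"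
          using KB1 l35 by (intro mult_left_mono) auto
        also have "\<dots> = 9 * (KB * l ^ 3)" by (simp add: power2_eq_square power3_eq_cube)
        also have "\<dots> \<le> 3888 * (KB * l ^ 3)" using den by simp
        finally have "10 ^ 9 * (KB * ln (2 * KA) * (ln (2 * KA * KB))\<^sup>2) * Z\<^sup>2 \<le> ln n"
          unfolding l_def[symmetric] by (rule suff)
        then show ?thesis
          using long_progression_if_sumset_large[OF fin ne KA KB Z1 KAZ KBZ] lnnZ by (simp add: n_def)
      next
        case False
        then have "KA * ln (2 * KB) * (ln (2 * KB * KA))\<^sup>2 \<le> 486 * KB"
          using KA1 by (intro swapped_rank_bound) auto
        also have "\<dots> \<le> 3888 * (KB * l ^ 3)" using l3 KB1 by (simp add: field_simps)
        finally have "10 ^ 9 * (KA * ln (2 * KB) * (ln (2 * KB * KA))\<^sup>2) * Z\<^sup>2 \<le> ln n" by (rule suff)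
        moreover have "real (card (B + A)) \<le> KB * real (card B)" "real (card (B + A)) \<le> KA * real (card A)"
          "ln (real (card (B + A))) = ln n" "B + A = A + B"
          using KA KB by (simp_all add: n_def add.commute)
        ultimately show ?thesis
          using long_progression_if_sumset_large[OF fin(2,1) ne(2,1), of KB KA Z] Z1 KAZ KBZ lnnZ by simp
      qed
      then obtain P L where P: "is_arith_prog P L" "P \<subseteq> A + B" "real L \<ge> exp Z" by blast
      have "c * X - ln q \<le> Z" using lnq X by (simp add: Z_def c_def)
      then have "exp (c * X - ln q) \<le> real L" using P(3) by (meson exp_le_cancel_iff order_trans)
      then show ?thesis using P(1,2) unfolding X_def n_def l_def q_def a_def by blast
    qed
  qed
  have "c > 0" by (simp add: c_def)
  with goal show ?thesis by blast
qed

end
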